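(* Let $e=\sqrt3$. For $k\ge1$ let $\mathcal{A}(12k+7)$ be the arrangement of $12k+7$ lines in $\mathbb{P}^2_{\mathbb{C}}$ with homogeneous coordinates $x,y,z$ consisting of the zero loci of the linear forms $$2x-eiz,\quad x-ey+iez,\quad x+ey-iez\qquad (i\in\{-(k+1),-k,\dots,k,k+1\}),$$ $$2y-jz,\quad ex-y+jz,\quad ex+y-jz\qquad (j\in\{-(k-1),\dots,k-1\}),$$ and $z$. Then the arrangements $\mathcal{A}(19,1):=\mathcal{A}(19)$ (the case $k=1$) and $\mathcal{A}(31,2):=\mathcal{A}(31)$ (the case $k=2$) are inductively free.
   Context: A line in $\mathbb{P}^2_{\mathbb{C}}$ is identified with a plane through the origin in $\mathbb{C}^3$, so line arrangements are regarded as arrangements of hyperplanes in $\mathbb{C}^3$. **Free arrangements.** Let $V$ be a vector space of dimension $\ell$ over a field $\mathbb{K}$ of characteristic zero (here $\mathbb{K}=\mathbb{C}$), with coordinate ring $R=\mathbb{K}[x_1,\dots,x_\ell]$. Let $\mathcal{B}$ be a finite set of hyperplanes through the origin in $V$, and let $Q(\mathcal{B})=\prod_{H\in\mathcal{B}}l_H$, where $l_H$ is a linear form with kernel $H$; the empty product is $1$. Let $D(\mathcal{B})$ be the $R$-module of $\mathbb{K}$-derivations $\theta:R\to R$ with $\theta(Q(\mathcal{B}))\in Q(\mathcal{B})R$. The arrangement $\mathcal{B}$ is free if $D(\mathcal{B})$ is a free $R$-module. In that case $\exp(\mathcal{B})$ is the multiset of polynomial degrees of the elements of a homogeneous basis of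 $D(\mathcal{B})$, where $\theta=\sum g_i\,\partial/\partial x_i$ with all $g_i$ homogeneous of degree $d$ has polynomial degree $d$. **Inductively free arrangements.** For $H\in\mathcal{B}$ put $\mathcal{B}'=\mathcal{B}\setminus\{H\}$ and $\mathcal{B}''=\{H\cap K : K\in\mathcal{B}'\}$, where $\mathcal{B}''$ is regarded as an arrangement of hyperplanes in the vector space $H$. The class of inductively free arrangements is the smallest class such that: (1) the empty arrangement in an $\ell$-dimensional space belongs to it for every $\ell\ge 0$; (2) if there is $H\in\mathcal{B}$ such that $\mathcal{B}'$ and $\mathcal{B}''$ belong to it and $\exp(\mathcal{B}'')\subset\exp(\mathcal{B}')$ as multisets, then $\mathcal{B}$ belongs to it. Every arrangement in this class is free, so the exponents are defined. *)

theory Defs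
  imports "HOL-Analysis.Cartesian_Space" "HOL-Library.Function_Algebras" "HOL-Library.Multiset"
begin

text \<open>
  The ambient vector space of an arrangement is a linear subspace \<open>V\<close> of \<open>'k ^ 'n\<close>, so that an
  arrangement can be restricted to one of its hyperplanes \<open>H\<close> by taking \<open>H\<close> itself as the new
  ambient space.  A function on \<open>V\<close> is represented by its extension by zero to \<open>'k ^ 'n\<close>, and a map
  on the coordinate ring of \<open>V\<close> by its extension by zero to all functions; in this way equality and
  the pointwise operations on the representatives are those of the represented objects.
\<close>

definition linear_forms :: "('k::field_char_0 ^ 'n) set \<Rightarrow> ('k ^ 'n \<Rightarrow> 'k) set" where
  "linear_forms V = {l. (\<forall>u\<in>V. \<forall>v\<in>V. l (u + v) = l u + l v) \<and>
                        (\<forall>a. \<forall>v\<in>V. l (a *s v) = a * l v) \<and>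
                        (\<forall>v. v \<notin> V \<longrightarrow> l v = 0)}"

definition const_on :: "('k::field_char_0 ^ 'n) set \<Rightarrow> 'k \<Rightarrow> 'k ^ 'n \<Rightarrow> 'k" where
  "const_on V a = (\<lambda>v. if v \<in> V then a else 0)"

text \<open>
  The coordinate ring as the ring of polynomial functions on \<open>V\<close>.  The field is infinite, so this
  is the polynomial ring in \<open>dim V\<close> indeterminates (any basis of the dual of \<open>V\<close>).
\<close>

inductive_set coord_ring :: "('k::field_char_0 ^ 'n) set \<Rightarrow> ('k ^ 'n \<Rightarrow> 'k) set"
  for V where
  const: "const_on V a \<in> coord_ring V"
| form: "l \<in> linear_forms V \<Longrightarrow> l \<in> coord_ring V"
| add: "f \<in> coord_ring V \<Longrightarrow> g \<in> coord_ring V \<Longrightarrow> f + g \<in> coord_ring V"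
| mult: "f \<in> coord_ring V \<Longrightarrow> g \<in> coord_ring V \<Longrightarrow> f * g \<in> coord_ring V"

inductive homogeneous :: "('k::field_char_0 ^ 'n) set \<Rightarrow> nat \<Rightarrow> ('k ^ 'n \<Rightarrow> 'k) \<Rightarrow> bool"
  for V where
  const: "homogeneous V 0 (const_on V a)"
| form: "l \<in> linear_forms V \<Longrightarrow> homogeneous V 1 l"
| add: "homogeneous V d f \<Longrightarrow> homogeneous V d g \<Longrightarrow> homogeneous V d (f + g)"
| mult: "homogeneous V d f \<Longrightarrow> homogeneous V e g \<Longrightarrow> homogeneous V (d + e) (f * g)"

definition derivations ::
  "('k::field_char_0 ^ 'n) set \<Rightarrow> (('k ^ 'n \<Rightarrow> 'k) \<Rightarrow> ('k ^ 'n \<Rightarrow> 'k)) set" where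
  "derivations V = {\<theta>.
     (\<forall>f\<in>coord_ring V. \<theta> f \<in> coord_ring V) \<and>
     (\<forall>f. f \<notin> coord_ring V \<longrightarrow> \<theta> f = 0) \<and>
     (\<forall>f\<in>coord_ring V. \<forall>g\<in>coord_ring V. \<theta> (f + g) = \<theta> f + \<theta> g) \<and>
     (\<forall>a. \<forall>f\<in>coord_ring V. \<theta> (const_on V a * f) = const_on V a * \<theta> f) \<and>
     (\<forall>f\<in>coord_ring V. \<forall>g\<in>coord_ring V. \<theta> (f * g) = \<theta> f * g + f * \<theta> g)}"

text \<open>
  If \<open>x\<^sub>1, \<dots>, x\<^sub>m\<close> are coordinates on \<open>V\<close> and \<open>\<theta> = \<Sum> g\<^sub>i \<partial>/\<partial>x\<^sub>i\<close>, then \<open>g\<^sub>i = \<theta> x\<^sub>i\<close>, and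
  the values of \<open>\<theta>\<close> on linear forms are the linear combinations of the \<open>g\<^sub>i\<close>.
\<close>

definition has_pdeg ::
  "('k::field_char_0 ^ 'n) set \<Rightarrow> (('k ^ 'n \<Rightarrow> 'k) \<Rightarrow> ('k ^ 'n \<Rightarrow> 'k)) \<Rightarrow> nat \<Rightarrow> bool" where
  "has_pdeg V \<theta> d \<longleftrightarrow> (\<forall>x\<in>linear_forms V. homogeneous V d (\<theta> x))"

definition hyperplane_of :: "('k::field_char_0 ^ 'n) set \<Rightarrow> ('k ^ 'n) set \<Rightarrow> bool" where
  "hyperplane_of V H \<longleftrightarrow> vec.subspace H \<and> H \<subseteq> V \<and> vec.dim V = vec.dim H + 1"

definition arrangement :: "('k::field_char_0 ^ 'n) set \<Rightarrow> ('k ^ 'n) set set \<Rightarrow> bool" where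
  "arrangement V \<B> \<longleftrightarrow> vec.subspace V \<and> finite \<B> \<and> (\<forall>H\<in>\<B>. hyperplane_of V H)"

definition form_of :: "('k::field_char_0 ^ 'n) set \<Rightarrow> ('k ^ 'n) set \<Rightarrow> 'k ^ 'n \<Rightarrow> 'k" where
  "form_of V H = (SOME l. l \<in> linear_forms V \<and> {v\<in>V. l v = 0} = H)"

definition defining_poly :: "('k::field_char_0 ^ 'n) set \<Rightarrow> ('k ^ 'n) set set \<Rightarrow> 'k ^ 'n \<Rightarrow> 'k" where
  "defining_poly V \<B> = const_on V 1 * (\<Prod>H\<in>\<B>. form_of V H)"

definition derivation_module ::
  "('k::field_char_0 ^ 'n) set \<Rightarrow> ('k ^ 'n) set set \<Rightarrow> (('k ^ 'n \<Rightarrow> 'k) \<Rightarrow> ('k ^ 'n \<Rightarrow> 'k)) set" where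
  "derivation_module V \<B> = {\<theta>\<in>derivations V.
     \<exists>g\<in>coord_ring V. \<theta> (defining_poly V \<B>) = defining_poly V \<B> * g}"

definition module_basis ::
  "('k::field_char_0 ^ 'n) set \<Rightarrow> ('k ^ 'n) set set \<Rightarrow>
   (('k ^ 'n \<Rightarrow> 'k) \<Rightarrow> ('k ^ 'n \<Rightarrow> 'k)) list \<Rightarrow> bool" where
  "module_basis V \<B> \<theta>s \<longleftrightarrow> set \<theta>s \<subseteq> derivation_module V \<B> \<and>
     (\<forall>\<eta>\<in>derivation_module V \<B>.
        \<exists>!cs. length cs = length \<theta>s \<and> set cs \<subseteq> coord_ring V \<and>
              (\<forall>f. \<eta> f = (\<Sum>i<length \<theta>s. cs ! i * (\<theta>s ! i) f)))"

text \<open>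
  \<open>exponents V \<B> E\<close>: the arrangement is free with multiset of exponents \<open>E\<close>.  The degrees of a
  homogeneous basis do not depend on the basis, so there is at most one such \<open>E\<close>.
\<close>

definition exponents ::
  "('k::field_char_0 ^ 'n) set \<Rightarrow> ('k ^ 'n) set set \<Rightarrow> nat multiset \<Rightarrow> bool" where
  "exponents V \<B> E \<longleftrightarrow>
     (\<exists>\<theta>s ds. module_basis V \<B> \<theta>s \<and> list_all2 (has_pdeg V) \<theta>s ds \<and> E = mset ds)"

inductive inductively_free :: "('k::field_char_0 ^ 'n) set \<Rightarrow> ('k ^ 'n) set set \<Rightarrow> bool" where
  empty: "vec.subspace V \<Longrightarrow> inductively_free V {}"
| add: "\<lbrakk>arrangement V \<B>; H \<in> \<B>;
         inductively_free V (\<B> - {H}); inductively_free H ((\<lambda>K. H \<inter> K) ` (\<B> - {H}));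
         exponents V (\<B> - {H}) E'; exponents H ((\<lambda>K. H \<inter> K) ` (\<B> - {H})) E''; E'' \<subseteq># E'\<rbrakk>
        \<Longrightarrow> inductively_free V \<B>"

text \<open>The projective line \<open>a x + b y + c z = 0\<close>, as a plane through the origin.\<close>

definition line :: "complex \<Rightarrow> complex \<Rightarrow> complex \<Rightarrow> (complex ^ 3) set" where
  "line a b c = {v. a * v $ 1 + b * v $ 2 + c * v $ 3 = 0}"

text \<open>The arrangement \<open>\<A>(12k + 7)\<close>, indexed by \<open>k\<close>.\<close>

definition arr_A :: "nat \<Rightarrow> (complex ^ 3) set set" where
  "arr_A k = (let e = complex_of_real (sqrt 3) in
     (\<Union>i\<in>{- (int k + 1)..int k + 1}.
        {line 2 0 (- e * of_int i), line 1 (- e) (e * of_int i), line 1 e (- e * of_int i)}) \<union>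
     (\<Union>j\<in>{- (int k - 1)..int k - 1}.
        {line 0 2 (- of_int j), line e (- 1) (of_int j), line e 1 (- of_int j)}) \<union>
     {line 0 0 1})"

end

theory Submission
  imports Defs "HOL-Computational_Algebra.Polynomial"
begin

text \<open>
  Both arrangements are built up one line at a time, starting from a single line and choosing each
  new line so that it meets the present lines in a number of points that the exponents predict.

  \<^item> Let \<open>A\<close> have exponents \<open>E + {b}\<close> and let its restriction to a new hyperplane \<open>H\<close> have exponents
    \<open>E\<close>.  By Terao's addition theorem (\<open>free_with_insert\<close>), \<open>A\<close> together with \<open>H\<close> is free with
    exponents \<open>E + {b + 1}\<close>.  The proof works in every dimension.  Derivations of
    the coordinate ring are the same thing as polynomial vector fields \<open>w : V \<rightarrow> V\<close>, and \<open>D(A)\<close>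
    consists of the fields with \<open>w(K) \<subseteq> K\<close> for all \<open>K\<close> in \<open>A\<close> (\<open>derivation_module_iff\<close>).  If \<open>\<alpha>\<close> is a
    linear form of \<open>H\<close>, then for all such \<open>w\<close> the function \<open>\<alpha>(w)\<close> restricted to \<open>H\<close> is a multiple of
    one fixed nonzero form \<open>B\<close> of degree \<open>b\<close> (\<open>form_value_factor\<close>).  Hence the basis elements of
    degree \<open>< b\<close> are tangent to \<open>H\<close>.  If those of degree \<open>b\<close> were so too, then their restrictions
    would be more independent elements of \<open>D\<close> of the restriction than its basis elements of degree
    \<open>\<le> b\<close> can accommodate (\<open>basis_element_not_tangent\<close>).  So some basis element \<open>w\<^sub>k\<close> of degree \<open>b\<close>
    has \<open>\<alpha>(w\<^sub>k) = \<kappa> B\<close> on \<open>H\<close> with a constant \<open>\<kappa> \<noteq> 0\<close>; replacing \<open>w\<^sub>k\<close> by \<open>\<alpha> w\<^sub>k\<close> and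
    correcting the others by multiples of \<open>w\<^sub>k\<close> gives the new basis (\<open>exchange_basis\<close>).

  \<^item> A nonempty set of \<open>n\<close> lines through the origin of a plane is inductively free with exponents
    \<open>{1, n - 1}\<close>.  So for lines in the projective plane the hypothesis of the addition theorem is purely combinatorial: if
    the exponents are \<open>{1, a, b}\<close> and the new line meets the old ones in exactly \<open>a + 1\<close> points, then
    the new exponents are \<open>{1, a, b + 1}\<close>.

  \<^item> In the coordinates \<open>(x, \<surd>3 y, \<surd>3 z)\<close> all lines of the two arrangements have integer
    coefficients up to a common factor, and points of intersection coincide exactly when a \<open>3 \<times> 3\<close> determinant vanishes.
    For suitable orders of the lines the numbers of points can be computed, and the exponents
    come out as \<open>{1, 7, 11}\<close> and \<open>{1, 13, 17}\<close>.
\<close>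

section \<open>The ring of polynomial functions on a subspace\<close>

lemma coord_ring_outside: "f \<in> coord_ring V \<Longrightarrow> v \<notin> V \<Longrightarrow> f v = 0"
  by (induction rule: coord_ring.induct) (auto simp: const_on_def linear_forms_def)

lemma coord_ring_eqI:
  assumes "f \<in> coord_ring V" "g \<in> coord_ring V" "\<And>v. v \<in> V \<Longrightarrow> f v = g v"
  shows "f = g"
proof
  fix v show "f v = g v"
    using assms coord_ring_outside[of f V v] coord_ring_outside[of g V v] by (cases "v \<in> V") auto
qed

lemma linear_forms_add: "l \<in> linear_forms V \<Longrightarrow> u \<in> V \<Longrightarrow> v \<in> V \<Longrightarrow> l (u + v) = l u + l v"
  and linear_forms_scale: "l \<in> linear_forms V \<Longrightarrow> v \<in> V \<Longrightarrow> l (a *s v) = a * l v"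
  and linear_forms_outside: "l \<in> linear_forms V \<Longrightarrow> v \<notin> V \<Longrightarrow> l v = 0"
  by (auto simp: linear_forms_def)

lemma linear_forms_zero: "l \<in> linear_forms V \<Longrightarrow> vec.subspace V \<Longrightarrow> l 0 = 0"
  using linear_forms_scale[of l V 0 0] by (simp add: vec.subspace_0)

lemma linear_forms_diff:
  assumes "l \<in> linear_forms V" "vec.subspace V" "u \<in> V" "v \<in> V"
  shows "l (u - v) = l u - l v"
proof -
  have "(-1) *s v \<in> V" using assms vec.subspace_scale by blast
  then have "l (u + (-1) *s v) = l u + (-1) * l v"
    using assms linear_forms_add linear_forms_scale by metis
  then show ?thesis by simp
qed

lemma linear_forms_diff_scaled:
  assumes "l \<in> linear_forms V" "vec.subspace V" "u \<in> V" "v \<in> V"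
  shows "l (u - a *s v) = l u - a * l v"
  using assms by (simp add: linear_forms_diff linear_forms_scale vec.subspace_scale)

lemma subspace_kernel:
  assumes V: "vec.subspace V" and l: "l \<in> linear_forms V"
  shows "vec.subspace {x\<in>V. l x = 0}"
  using V linear_forms_zero[OF l V] vec.subspace_add[OF V] vec.subspace_scale[OF V] vec.subspace_0[OF V] l
  by (auto simp: vec.subspace_def linear_forms_add linear_forms_scale)

lemma coord_ring_zero: "0 \<in> coord_ring V"
proof -
  have "const_on V 0 = 0" by (auto simp: const_on_def)
  then show ?thesis by (metis coord_ring.const)
qed

lemma coord_ring_scale: "f \<in> coord_ring V \<Longrightarrow> (\<lambda>v. a * f v) \<in> coord_ring V"
proof -
  assume f: "f \<in> coord_ring V"
  have "const_on V a * f = (\<lambda>v. a * f v)"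
    using coord_ring_outside[OF f] by (auto simp: const_on_def fun_eq_iff)
  then show ?thesis using f by (metis coord_ring.const coord_ring.mult)
qed

lemma coord_ring_uminus: "f \<in> coord_ring V \<Longrightarrow> - f \<in> coord_ring V"
  using coord_ring_scale[of f V "-1"] by (simp add: fun_Compl_def)

lemma coord_ring_diff: "f \<in> coord_ring V \<Longrightarrow> g \<in> coord_ring V \<Longrightarrow> f - g \<in> coord_ring V"
  using coord_ring.add[of f V "- g"] coord_ring_uminus[of g V] by simp

lemma coord_ring_sum: "(\<And>i. i \<in> I \<Longrightarrow> f i \<in> coord_ring V) \<Longrightarrow> (\<Sum>i\<in>I. f i) \<in> coord_ring V"
  by (induction I rule: infinite_finite_induct) (auto simp: coord_ring_zero coord_ring.add)

lemma coord_ring_prod_mult: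
  "(\<And>i. i \<in> I \<Longrightarrow> f i \<in> coord_ring V) \<Longrightarrow> g \<in> coord_ring V \<Longrightarrow> (\<Prod>i\<in>I. f i) * g \<in> coord_ring V"
  by (induction I rule: infinite_finite_induct) (auto simp: mult.assoc coord_ring.mult)

lemma coord_ring_power_mult:
  "f \<in> coord_ring V \<Longrightarrow> g \<in> coord_ring V \<Longrightarrow> f ^ m * g \<in> coord_ring V"
  by (induction m) (auto simp: mult.assoc coord_ring.mult)

lemma fun_sum_apply: "(\<Sum>i\<in>I. f i) x = (\<Sum>i\<in>I. f i x)"
  by (induction I rule: infinite_finite_induct) auto

lemma fun_prod_apply: "(\<Prod>i\<in>I. f i) x = (\<Prod>i\<in>I. f i x)"
  by (induction I rule: infinite_finite_induct) auto

lemma fun_power_apply: "((f :: 'a \<Rightarrow> 'b::comm_ring_1) ^ m) x = f x ^ m"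
  by (induction m) auto

text \<open>
  Most facts about polynomial functions are reduced to polynomials in one indeterminate in this
  way.
\<close>

lemma coord_ring_on_line:
  assumes "vec.subspace V" "f \<in> coord_ring V" "x \<in> V" "v \<in> V"
  shows "\<exists>p. \<forall>t. f (x + t *s v) = poly p t"
proof -
  have mem: "x + t *s v \<in> V" for t
    using assms vec.subspace_add vec.subspace_scale by blast
  show ?thesis using assms(2)
  proof induction
    case (const a)
    then show ?case using mem by (intro exI[of _ "[:a:]"]) (auto simp: const_on_def)
  next
    case (form l)
    then have "l (x + t *s v) = l x + t * l v" for t
      using assms by (simp add: linear_forms_add linear_forms_scale vec.subspace_scale)
    then show ?case by (intro exI[of _ "[:l x, l v:]"]) auto
  next
    case (add f g)
    then obtain p q where "\<forall>t. f (x + t *s v) = poly p t" "\<forall>t. g (x + t *s v) = poly q t" by blast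
    then show ?case by (intro exI[of _ "p + q"]) auto
  next
    case (mult f g)
    then obtain p q where "\<forall>t. f (x + t *s v) = poly p t" "\<forall>t. g (x + t *s v) = poly q t" by blast
    then show ?case by (intro exI[of _ "p * q"]) auto
  qed
qed

text \<open>
  A function that does not vanish at \<open>x\<close> and one that does not vanish at \<open>y\<close> are nonzero polynomials
  on the line through \<open>x\<close> and \<open>y\<close>.  The subspace \<open>H\<close> makes this usable as the primality of the ideal
  of functions vanishing on \<open>H\<close>.
\<close>

lemma coord_ring_domain:
  assumes V: "vec.subspace V" and H: "vec.subspace H" "H \<subseteq> V"
    and fg: "f \<in> coord_ring V" "g \<in> coord_ring V"
    and prod: "\<And>x. x \<in> H \<Longrightarrow> f x * g x = 0"
  shows "(\<forall>x\<in>H. f x = 0) \<or> (\<forall>x\<in>H. g x = 0)"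
proof (rule ccontr)
  assume "\<not> ?thesis"
  then obtain x y where xy: "x \<in> H" "f x \<noteq> 0" "y \<in> H" "g y \<noteq> 0" by blast
  define v where "v = y - x"
  have v: "v \<in> H" using xy H unfolding v_def by (simp add: vec.subspace_diff)
  obtain p q where p: "\<And>t. f (x + t *s v) = poly p t" and q: "\<And>t. g (x + t *s v) = poly q t"
    using coord_ring_on_line[OF V fg(1), of x v] coord_ring_on_line[OF V fg(2), of x v] H xy v by blast
  have "poly p 0 \<noteq> 0" using p[of 0] xy by simp
  moreover have "poly q 1 \<noteq> 0" using q[of 1] xy by (simp add: v_def)
  moreover have "poly (p * q) t = 0" for t
  proof -
    have "x + t *s v \<in> H" using H xy v vec.subspace_add vec.subspace_scale by blast
    then show ?thesis using prod[of "x + t *s v"] p q by (metis poly_mult)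
  qed
  then have "p * q = 0" by (simp add: poly_all_0_iff_0 [symmetric])
  ultimately show False by auto
qed

lemma coord_ring_cancel:
  assumes V: "vec.subspace V" and "h \<in> coord_ring V" "f \<in> coord_ring V" "g \<in> coord_ring V"
    and "h \<noteq> 0" "h * f = h * g"
  shows "f = g"
proof -
  have "h x * (f - g) x = 0" for x
    using fun_cong[OF assms(6), of x] by (simp add: algebra_simps)
  then have "(\<forall>x\<in>V. h x = 0) \<or> (\<forall>x\<in>V. (f - g) x = 0)"
    using coord_ring_domain[OF V V order_refl assms(2) coord_ring_diff[OF assms(3,4)]] by blast
  moreover have "\<not> (\<forall>x\<in>V. h x = 0)"
    using assms(2,5) coord_ring_outside by (metis ext zero_fun_apply)
  ultimately show ?thesis by (intro coord_ring_eqI[OF assms(3,4)]) auto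
qed

lemma coord_ring_nonvanishing:
  assumes V: "vec.subspace V" and H: "vec.subspace H" "H \<subseteq> V" and "finite I"
    and "\<And>i. i \<in> I \<Longrightarrow> f i \<in> coord_ring V \<and> (\<exists>x\<in>H. f i x \<noteq> 0)"
  shows "\<exists>x\<in>H. \<forall>i\<in>I. f i x \<noteq> 0"
  using assms(4,5)
proof (induction rule: finite_induct)
  case empty
  then show ?case using H vec.subspace_0 by auto
next
  case (insert i I)
  let ?p = "(\<Prod>i\<in>I. f i) * const_on V 1"
  have p: "?p \<in> coord_ring V"
    using insert.prems by (intro coord_ring_prod_mult) (auto intro: coord_ring.const)
  have p_apply: "?p x = (\<Prod>i\<in>I. f i x)" if "x \<in> H" for x
    using that H by (auto simp: fun_prod_apply const_on_def)
  obtain x where "x \<in> H" "?p x \<noteq> 0"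
    using insert by (metis p_apply insertI2 prod_zero_iff)
  moreover obtain y where "y \<in> H" "f i y \<noteq> 0" using insert by blast
  ultimately obtain z where z: "z \<in> H" "?p z * f i z \<noteq> 0"
    using coord_ring_domain[OF V H p, of "f i"] insert.prems by blast
  then have "(\<Prod>i\<in>I. f i z) \<noteq> 0" "f i z \<noteq> 0"
    using p_apply[OF z(1)] by auto
  then show ?case
    using z(1) prod_zero_iff[OF insert.hyps(1)] by blast
qed

lemma coord_ring_pullback:
  assumes add: "\<And>u v. u \<in> V \<Longrightarrow> v \<in> V \<Longrightarrow> L (u + v) = L u + L v"
    and scale: "\<And>a v. v \<in> V \<Longrightarrow> L (a *s v) = a *s L v"
    and into: "\<And>v. v \<in> V \<Longrightarrow> L v \<in> W"
    and V: "vec.subspace V" and f: "f \<in> coord_ring W"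
  shows "(\<lambda>v. if v \<in> V then f (L v) else 0) \<in> coord_ring V"
  using f
proof induction
  case (const a)
  have "(\<lambda>v. if v \<in> V then const_on W a (L v) else 0) = const_on V a"
    using into by (auto simp: const_on_def)
  then show ?case by (simp add: coord_ring.const)
next
  case (form l)
  then have "(\<lambda>v. if v \<in> V then l (L v) else 0) \<in> linear_forms V"
    using add scale into vec.subspace_add[OF V] vec.subspace_scale[OF V]
    by (auto simp: linear_forms_def)
  then show ?case by (rule coord_ring.form)
next
  case (add f g)
  from coord_ring.add[OF add.IH] show ?case
    by (rule back_subst[where P = "\<lambda>h. h \<in> coord_ring V"]) auto
next
  case (mult f g)
  from coord_ring.mult[OF mult.IH] show ?case
    by (rule back_subst[where P = "\<lambda>h. h \<in> coord_ring V"]) auto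
qed

lemma coord_ring_restrict:
  assumes "vec.subspace H" "H \<subseteq> V" "f \<in> coord_ring V"
  shows "(\<lambda>v. if v \<in> H then f v else 0) \<in> coord_ring H"
  using assms by (intro coord_ring_pullback[where W = V]) auto

lemma linear_forms_restrict:
  assumes "vec.subspace H" "H \<subseteq> V" "l \<in> linear_forms V"
  shows "(\<lambda>v. if v \<in> H then l v else 0) \<in> linear_forms H"
  using assms vec.subspace_add[OF assms(1)] vec.subspace_scale[OF assms(1)]
  by (auto simp: linear_forms_def subset_iff)

text \<open>
  Choose \<open>w\<close> with \<open>l(w) = 1\<close> and let \<open>P x = x - l(x) w\<close> be the projection along \<open>w\<close> onto the kernel
  of \<open>l\<close>.  By induction on \<open>f\<close>, the difference \<open>f - f \<circ> P\<close> is a multiple of \<open>l\<close>; and \<open>f \<circ> P = 0\<close> if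
  \<open>f\<close> vanishes on the kernel.
\<close>

lemma coord_ring_factor:
  assumes V: "vec.subspace V" and l: "l \<in> linear_forms V"
    and f: "f \<in> coord_ring V" and zero: "\<And>x. x \<in> V \<Longrightarrow> l x = 0 \<Longrightarrow> f x = 0"
  shows "\<exists>g\<in>coord_ring V. f = l * g"
proof (cases "\<exists>v\<in>V. l v \<noteq> 0")
  case False
  then have "f = 0" using zero coord_ring_outside[OF f] by (auto simp: fun_eq_iff)
  then show ?thesis using coord_ring_zero by (intro bexI[of _ 0]) auto
next
  case True
  then obtain v where v: "v \<in> V" "l v \<noteq> 0" by blast
  define w where "w = (1 / l v) *s v"
  have w: "w \<in> V" "l w = 1"
    using v l V by (auto simp: w_def vec.subspace_scale linear_forms_scale)
  define P where "P x = x - l x *s w" for x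
  have P: "P x \<in> V" "l (P x) = 0" if "x \<in> V" for x
    using that w V l by (auto simp: P_def vec.subspace_diff vec.subspace_scale linear_forms_diff_scaled)
  have "\<exists>g\<in>coord_ring V. \<forall>x\<in>V. f x - f (P x) = l x * g x" using f
  proof induction
    case (const a)
    show ?case using P(1) by (intro bexI[OF _ coord_ring_zero]) (auto simp: const_on_def)
  next
    case (form m)
    then have "m x - m (P x) = l x * const_on V (m w) x" if "x \<in> V" for x
      using that w V by (simp add: P_def linear_forms_diff_scaled const_on_def)
    then show ?case using coord_ring.const by blast
  next
    case (add f g)
    then obtain p q where pq: "p \<in> coord_ring V" "\<forall>x\<in>V. f x - f (P x) = l x * p x"
      "q \<in> coord_ring V" "\<forall>x\<in>V. g x - g (P x) = l x * q x" by blast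
    show ?case
    proof (intro bexI ballI)
      fix x assume "x \<in> V"
      then have "f x - f (P x) = l x * p x" "g x - g (P x) = l x * q x" using pq by auto
      then show "(f + g) x - (f + g) (P x) = l x * (p + q) x"
        unfolding plus_fun_apply by algebra
    qed (intro coord_ring.add pq)
  next
    case (mult f g)
    then obtain p q where pq: "p \<in> coord_ring V" "\<forall>x\<in>V. f x - f (P x) = l x * p x"
      "q \<in> coord_ring V" "\<forall>x\<in>V. g x - g (P x) = l x * q x" by blast
    let ?fP = "\<lambda>x. if x \<in> V then f (P x) else 0"
    have fP: "?fP \<in> coord_ring V"
      by (rule coord_ring_pullback[OF _ _ P(1) V mult.hyps(1)])
        (use l in \<open>auto simp: P_def linear_forms_add linear_forms_scale algebra_simps
           vec.scale_right_diff_distrib\<close>)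
    show ?case
    proof (intro bexI ballI)
      fix x assume "x \<in> V"
      then have "f x - f (P x) = l x * p x" "g x - g (P x) = l x * q x" "?fP x = f (P x)"
        using pq by auto
      then show "(f * g) x - (f * g) (P x) = l x * (p * g + ?fP * q) x"
        unfolding plus_fun_apply times_fun_apply by algebra
    qed (intro coord_ring.add coord_ring.mult pq fP mult.hyps)
  qed
  then obtain g where "g \<in> coord_ring V" "\<And>x. x \<in> V \<Longrightarrow> f x - f (P x) = l x * g x" by blast
  then have "f = l * g"
    using zero P coord_ring_outside[OF f] linear_forms_outside[OF l] by (force simp: fun_eq_iff)
  then show ?thesis using \<open>g \<in> coord_ring V\<close> by blast
qed

lemma coord_ring_power_dvd_cancel:
  assumes V: "vec.subspace V" and l: "l \<in> linear_forms V" "\<exists>x\<in>V. l x \<noteq> 0"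
    and p: "p \<in> coord_ring V" "\<exists>x\<in>V. l x = 0 \<and> p x \<noteq> 0"
    and "g \<in> coord_ring V" "r \<in> coord_ring V" "p * g = l ^ m * r"
  shows "\<exists>g'\<in>coord_ring V. g = l ^ m * g'"
  using assms(6-8)
proof (induction m arbitrary: g)
  case 0
  then show ?case by auto
next
  case (Suc m)
  define K where "K = {x\<in>V. l x = 0}"
  have K: "vec.subspace K" "K \<subseteq> V"
    using subspace_kernel[OF V l(1)] by (auto simp: K_def)
  have "p x * g x = 0" if "x \<in> K" for x
    using that fun_cong[OF Suc.prems(3), of x] by (auto simp: K_def)
  then have "\<forall>x\<in>K. g x = 0"
    using coord_ring_domain[OF V K p(1) Suc.prems(1)] p(2) by (auto simp: K_def)
  then obtain h where h: "h \<in> coord_ring V" "g = l * h"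
    using coord_ring_factor[OF V l(1) Suc.prems(1)] by (auto simp: K_def)
  have "p * h = l ^ m * r"
  proof (rule coord_ring_cancel[OF V])
    have "l * (p * h) = p * g" by (simp only: h mult_ac)
    also have "\<dots> = l * (l ^ m * r)" using Suc.prems(3) by (simp only: power_Suc mult.assoc)
    finally show "l * (p * h) = l * (l ^ m * r)" .
    show "l \<in> coord_ring V" "p * h \<in> coord_ring V" "l ^ m * r \<in> coord_ring V"
      by (intro coord_ring.mult coord_ring.form coord_ring_power_mult l p h Suc.prems)+
    show "l \<noteq> 0" using l by auto
  qed
  then obtain h' where "h' \<in> coord_ring V" "h = l ^ m * h'"
    using Suc.IH h Suc.prems(2) by blast
  then have "g = l ^ Suc m * h'" by (simp only: h power_Suc mult_ac)
  then show ?case using \<open>h' \<in> coord_ring V\<close> by blast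
qed

text \<open>
  Linear forms with different kernels are pairwise coprime primes of the coordinate ring.
\<close>

lemma coord_ring_prod_dvd:
  assumes V: "vec.subspace V" and "finite S"
    and l: "\<And>s. s \<in> S \<Longrightarrow> l s \<in> linear_forms V" "\<And>s. s \<in> S \<Longrightarrow> \<exists>x\<in>V. l s x \<noteq> 0"
    and indep: "\<And>s t. s \<in> S \<Longrightarrow> t \<in> S \<Longrightarrow> s \<noteq> t \<Longrightarrow> \<exists>x\<in>V. l t x = 0 \<and> l s x \<noteq> 0"
    and f: "f \<in> coord_ring V"
    and dvd: "\<And>s. s \<in> S \<Longrightarrow> \<exists>g\<in>coord_ring V. f = l s ^ m s * g"
  shows "\<exists>g\<in>coord_ring V. f = (\<Prod>s\<in>S. l s ^ m s) * g"
  using assms(2) l indep dvd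
proof (induction rule: finite_induct)
  case empty
  then show ?case using f by auto
next
  case (insert t S)
  have "\<exists>g\<in>coord_ring V. f = (\<Prod>s\<in>S. l s ^ m s) * g"
    using insert.prems by (intro insert.IH) auto
  then obtain g where g: "g \<in> coord_ring V" "f = (\<Prod>s\<in>S. l s ^ m s) * g" by blast
  let ?p = "(\<Prod>s\<in>S. l s ^ m s) * const_on V 1"
  have one: "const_on V 1 * g = g"
    using coord_ring_outside[OF g(1)] by (auto simp: const_on_def fun_eq_iff)
  have lS: "l s \<in> coord_ring V" if "s \<in> S" for s
    using insert.prems(1)[of s] that by (auto intro: coord_ring.form)
  have p: "?p \<in> coord_ring V"
    unfolding prod_power_distrib [symmetric]
    using lS
    by (induction S rule: infinite_finite_induct)
      (auto simp: mult.assoc intro: coord_ring_power_mult coord_ring.const)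
  define K where "K = {x\<in>V. l t x = 0}"
  have lt: "l t \<in> linear_forms V" using insert.prems by auto
  have K: "vec.subspace K" "K \<subseteq> V"
    using subspace_kernel[OF V lt] by (auto simp: K_def)
  have "l s \<in> coord_ring V \<and> (\<exists>x\<in>K. l s x \<noteq> 0)" if "s \<in> S" for s
  proof -
    have "s \<noteq> t" using that insert.hyps by blast
    then show ?thesis using insert.prems(3)[of s t] that lS unfolding K_def by auto
  qed
  then obtain x where "x \<in> K" "\<forall>s\<in>S. l s x \<noteq> 0"
    using coord_ring_nonvanishing[OF V K insert.hyps(1)] by blast
  then have px: "\<exists>x\<in>V. l t x = 0 \<and> ?p x \<noteq> 0"
    using insert.hyps by (auto simp: K_def fun_prod_apply fun_power_apply const_on_def intro!: bexI[of _ x])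
  obtain r where r: "r \<in> coord_ring V" "f = l t ^ m t * r" using insert.prems(4)[of t] by blast
  have "?p * g = l t ^ m t * r" using g(2) r(2) one by (simp add: mult.assoc)
  then obtain g' where g': "g' \<in> coord_ring V" "g = l t ^ m t * g'"
    using coord_ring_power_dvd_cancel[OF V lt _ p px g(1) r(1)] insert.prems(2)[of t] by blast
  then have "f = (\<Prod>s\<in>insert t S. l s ^ m s) * g'"
    using g(2) insert.hyps by (simp add: mult_ac)
  then show ?case using g' by blast
qed

section \<open>Homogeneous functions\<close>

lemma homogeneous_zero: "homogeneous V d 0"
proof (induction d)
  case 0
  have "const_on V 0 = 0" by (auto simp: const_on_def)
  then show ?case by (metis homogeneous.const)
next
  case (Suc d)
  have "(0 :: 'a ^ 'b \<Rightarrow> 'a) \<in> linear_forms V" by (simp add: linear_forms_def)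
  then have "homogeneous V (1 + d) (0 * 0)" by (intro homogeneous.mult homogeneous.form Suc)
  then show ?case by (simp only: mult_zero_left plus_1_eq_Suc)
qed

lemma homogeneous_sum: "(\<And>i. i \<in> I \<Longrightarrow> homogeneous V d (f i)) \<Longrightarrow> homogeneous V d (\<Sum>i\<in>I. f i)"
  by (induction I rule: infinite_finite_induct) (auto intro: homogeneous_zero homogeneous.add)

lemma homogeneous_coord_ring: "homogeneous V d f \<Longrightarrow> f \<in> coord_ring V"
  by (induction rule: homogeneous.induct) 
    (rule coord_ring.const | rule coord_ring.form, assumption | rule coord_ring.add, assumption+
      | rule coord_ring.mult, assumption+)+

lemma homogeneous_scaling:
  assumes "homogeneous V d f" "vec.subspace V" "x \<in> V"
  shows "f (t *s x) = t ^ d * f x"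
  using assms
  by (induction rule: homogeneous.induct)
    (auto simp: const_on_def vec.subspace_scale linear_forms_scale power_add algebra_simps)

text \<open>
  The homogeneous component of degree \<open>d\<close>.
\<close>

definition homogeneous_part :: "('k::field_char_0 ^ 'n) set \<Rightarrow> nat \<Rightarrow> ('k ^ 'n \<Rightarrow> 'k) \<Rightarrow> 'k ^ 'n \<Rightarrow> 'k" where
  "homogeneous_part V d f = (\<lambda>x. if x \<in> V then poly.coeff (THE p. \<forall>t. f (t *s x) = poly p t) d else 0)"

lemma the_poly_eq: "(THE p. \<forall>t. h t = poly p t) = q" if "\<And>t. h t = poly q t"
  for q :: "'k::field_char_0 poly"
proof (rule the_equality)
  fix p assume "\<forall>t. h t = poly p t"
  then have "poly p = poly q" using that by auto
  then show "p = q" by (simp add: poly_eq_poly_eq_iff)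
qed (use that in auto)

lemma homogeneous_part_eq:
  assumes "\<And>t. f (t *s x) = poly p t" "x \<in> V"
  shows "homogeneous_part V d f x = poly.coeff p d"
  using the_poly_eq[of "\<lambda>t. f (t *s x)" p] assms by (simp add: homogeneous_part_def)

lemma coord_ring_on_ray:
  assumes "vec.subspace V" "f \<in> coord_ring V" "x \<in> V"
  shows "\<exists>p. \<forall>t. f (t *s x) = poly p t"
  using coord_ring_on_line[of V f 0 x] assms by (simp add: vec.subspace_0)

lemma homogeneous_homogeneous_part:
  assumes V: "vec.subspace V" and "f \<in> coord_ring V"
  shows "homogeneous V d (homogeneous_part V d f)"
  using assms(2)
proof (induction arbitrary: d)
  case (const a)
  have "homogeneous_part V d (const_on V a) x = (if d = 0 then const_on V a x else 0)" for x
  proof (cases "x \<in> V")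
    case True
    have "homogeneous_part V d (const_on V a) x = poly.coeff [:a:] d"
      by (rule homogeneous_part_eq) (use True V in \<open>auto simp: const_on_def vec.subspace_scale\<close>)
    then show ?thesis using True by (simp add: const_on_def coeff_pCons split: nat.split)
  qed (simp add: homogeneous_part_def const_on_def)
  then have "homogeneous_part V d (const_on V a) = (if d = 0 then const_on V a else 0)" by auto
  then show ?case using homogeneous.const homogeneous_zero by auto
next
  case (form l)
  have "homogeneous_part V d l x = (if d = 1 then l x else 0)" for x
  proof (cases "x \<in> V")
    case True
    have "homogeneous_part V d l x = poly.coeff [:0, l x:] d"
      by (rule homogeneous_part_eq) (use True form in \<open>auto simp: linear_forms_scale\<close>)
    then show ?thesis using True by (auto simp add: coeff_pCons split: nat.split)
  qed (use form in \<open>simp add: homogeneous_part_def linear_forms_outside\<close>)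
  then have "homogeneous_part V d l = (if d = 1 then l else 0)" by auto
  then show ?case using homogeneous.form[OF form] homogeneous_zero by auto
next
  case (add f g)
  have "homogeneous_part V d (f + g) x = (homogeneous_part V d f + homogeneous_part V d g) x" for x
  proof (cases "x \<in> V")
    case True
    obtain p q where pq: "\<And>t. f (t *s x) = poly p t" "\<And>t. g (t *s x) = poly q t"
      using coord_ring_on_ray[OF V _ True] add.hyps by metis
    have "homogeneous_part V d (f + g) x = poly.coeff (p + q) d"
      by (rule homogeneous_part_eq) (use True pq in auto)
    then show ?thesis using True by (simp add: homogeneous_part_eq[OF pq(1)] homogeneous_part_eq[OF pq(2)])
  qed (simp add: homogeneous_part_def)
  then have "homogeneous_part V d (f + g) = homogeneous_part V d f + homogeneous_part V d g" by auto
  then show ?case using homogeneous.add[OF add.IH] by metis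
next
  case (mult f g)
  have "homogeneous_part V d (f * g) x = (\<Sum>i\<le>d. homogeneous_part V i f * homogeneous_part V (d - i) g) x" for x
  proof (cases "x \<in> V")
    case True
    obtain p q where pq: "\<And>t. f (t *s x) = poly p t" "\<And>t. g (t *s x) = poly q t"
      using coord_ring_on_ray[OF V _ True] mult.hyps by metis
    have "homogeneous_part V d (f * g) x = poly.coeff (p * q) d"
      by (rule homogeneous_part_eq) (use True pq in auto)
    then show ?thesis using True
      by (simp add: homogeneous_part_eq[OF pq(1)] homogeneous_part_eq[OF pq(2)] coeff_mult fun_sum_apply)
  qed (simp add: homogeneous_part_def fun_sum_apply)
  then have eq: "homogeneous_part V d (f * g)
      = (\<Sum>i\<le>d. homogeneous_part V i f * homogeneous_part V (d - i) g)" by auto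
  have "homogeneous V d (homogeneous_part V i f * homogeneous_part V (d - i) g)" if "i \<le> d" for i
    using homogeneous.mult[OF mult.IH(1)[of i] mult.IH(2)[of "d - i"]] that by simp
  then show ?case unfolding eq by (intro homogeneous_sum) auto
qed

text \<open>
  Together with \<open>homogeneous_scaling\<close> this characterises homogeneity by the behaviour under
  scaling, which is easier to verify than an inductive generation: such an \<open>f\<close> equals its own
  part of degree \<open>d\<close>.
\<close>

lemma homogeneousI:
  assumes V: "vec.subspace V" and f: "f \<in> coord_ring V"
    and scaling: "\<And>t x. x \<in> V \<Longrightarrow> f (t *s x) = t ^ d * f x"
  shows "homogeneous V d f"
proof -
  have "homogeneous_part V d f x = f x" for x
  proof (cases "x \<in> V")
    case True
    have "homogeneous_part V d f x = poly.coeff (monom (f x) d) d"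
      by (rule homogeneous_part_eq) (use True scaling in \<open>auto simp: poly_monom\<close>)
    then show ?thesis by simp
  qed (use coord_ring_outside[OF f] in \<open>simp add: homogeneous_part_def\<close>)
  then have "homogeneous_part V d f = f" by auto
  then show ?thesis using homogeneous_homogeneous_part[OF V f, of d] by simp
qed

text \<open>
  Formally \<open>f\<close> is homogeneous of the negative degree \<open>d - e\<close>.
\<close>

lemma scaling_degree_zero:
  assumes V: "vec.subspace V" and f: "f \<in> coord_ring V" and x: "x \<in> V" and "d < e"
    and eq: "\<And>t. t ^ e * f (t *s x) = t ^ d * f x"
  shows "f x = 0"
proof -
  obtain p where p: "\<And>t. f (t *s x) = poly p t" using coord_ring_on_ray[OF V f x] by blast
  have "poly (monom 1 e * p) t = poly (monom (f x) d) t" for t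
    using eq[of t] p[of t] by (simp add: poly_monom mult.commute)
  then have "monom 1 e * p = monom (f x) d"
    by (metis ext poly_eq_poly_eq_iff)
  then have "poly.coeff (monom 1 e * p) d = f x" by simp
  then show ?thesis using \<open>d < e\<close> by (simp add: coeff_monom_mult)
qed

lemma scaling_degree_eq:
  assumes V: "vec.subspace V" and f: "f \<in> coord_ring V" and x: "x \<in> V"
    and eq: "\<And>t. t ^ d * f (t *s x) = t ^ d * f x"
  shows "f x = f 0"
proof -
  obtain p where p: "\<And>t. f (t *s x) = poly p t" using coord_ring_on_ray[OF V f x] by blast
  have "poly (monom 1 d * p) t = poly (monom (f x) d) t" for t
    using eq[of t] p[of t] by (simp add: poly_monom mult.commute)
  then have "monom 1 d * p = monom (f x) d"
    by (metis ext poly_eq_poly_eq_iff)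
  then have "poly.coeff (monom 1 d * p) d = f x" by simp
  then show ?thesis using p[of 0] by (simp add: coeff_monom_mult poly_0_coeff_0)
qed

section \<open>Derivations as polynomial vector fields\<close>

text \<open>
  The derivative of \<open>f\<close> at \<open>x\<close> in direction \<open>v\<close>, defined algebraically so that it makes sense over
  every field of characteristic zero.
\<close>

definition dir_deriv :: "('k::field_char_0 ^ 'n \<Rightarrow> 'k) \<Rightarrow> 'k ^ 'n \<Rightarrow> 'k ^ 'n \<Rightarrow> 'k" where
  "dir_deriv f x v = poly.coeff (THE p. \<forall>t. f (x + t *s v) = poly p t) 1"

lemma dir_deriv_eq:
  assumes "\<And>t. f (x + t *s v) = poly p t"
  shows "dir_deriv f x v = poly.coeff p 1"
  using the_poly_eq[of "\<lambda>t. f (x + t *s v)" p] assms by (simp add: dir_deriv_def)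

lemma
  fixes V :: "('k::field_char_0 ^ 'n) set"
  assumes V: "vec.subspace V" and x: "x \<in> V" and v: "v \<in> V"
  shows dir_deriv_const: "dir_deriv (const_on V a) x v = 0"
    and dir_deriv_form: "l \<in> linear_forms V \<Longrightarrow> dir_deriv l x v = l v"
    and dir_deriv_add: "f \<in> coord_ring V \<Longrightarrow> g \<in> coord_ring V \<Longrightarrow>
      dir_deriv (f + g) x v = dir_deriv f x v + dir_deriv g x v"
    and dir_deriv_mult: "f \<in> coord_ring V \<Longrightarrow> g \<in> coord_ring V \<Longrightarrow>
      dir_deriv (f * g) x v = dir_deriv f x v * g x + f x * dir_deriv g x v"
proof -
  have mem: "x + t *s v \<in> V" for t using V x v vec.subspace_add vec.subspace_scale by blast
  have "dir_deriv (const_on V a) x v = poly.coeff [:a:] 1"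
    by (rule dir_deriv_eq) (use mem in \<open>auto simp: const_on_def\<close>)
  then show "dir_deriv (const_on V a) x v = 0" by simp
  show "dir_deriv l x v = l v" if l: "l \<in> linear_forms V"
  proof -
    have "dir_deriv l x v = poly.coeff [:l x, l v:] 1"
      by (rule dir_deriv_eq)
        (use V x v l in \<open>simp add: linear_forms_add linear_forms_scale vec.subspace_scale\<close>)
    then show ?thesis by simp
  qed
  assume fg: "f \<in> coord_ring V" "g \<in> coord_ring V"
  obtain p q where pq: "\<And>t. f (x + t *s v) = poly p t" "\<And>t. g (x + t *s v) = poly q t"
    using coord_ring_on_line[OF V _ x v] fg by metis
  note d = dir_deriv_eq[of f, OF pq(1)] dir_deriv_eq[of g, OF pq(2)]
  have "dir_deriv (f + g) x v = poly.coeff (p + q) 1"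
    by (rule dir_deriv_eq) (use pq in auto)
  then show "dir_deriv (f + g) x v = dir_deriv f x v + dir_deriv g x v" by (simp add: d)
  have "dir_deriv (f * g) x v = poly.coeff (p * q) 1"
    by (rule dir_deriv_eq) (use pq in auto)
  moreover have "f x = poly.coeff p 0" "g x = poly.coeff q 0"
    using pq(1)[of 0] pq(2)[of 0] by (simp_all add: poly_0_coeff_0)
  ultimately show "dir_deriv (f * g) x v = dir_deriv f x v * g x + f x * dir_deriv g x v"
    by (simp add: d coeff_mult atMost_Suc)
qed

definition coordinate :: "('k::field_char_0 ^ 'n) set \<Rightarrow> 'n \<Rightarrow> 'k ^ 'n \<Rightarrow> 'k" where
  "coordinate V i = (\<lambda>v. if v \<in> V then v $ i else 0)"

lemma coordinate_form: "vec.subspace V \<Longrightarrow> coordinate V i \<in> linear_forms V"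
  using vec.subspace_add[of V] vec.subspace_scale[of V] by (auto simp: coordinate_def linear_forms_def)

lemma linear_projection_matrix:
  assumes V: "vec.subspace (V :: ('k::field_char_0 ^ 'n) set)"
  obtains M where "\<And>v. M *v v \<in> V" "\<And>v. v \<in> V \<Longrightarrow> M *v v = v"
proof -
  obtain B where B: "B \<subseteq> V" "vec.independent B" "V \<subseteq> vec.span B"
    using vec.basis_exists[of V] by metis
  then have span: "vec.span B = V" using V by (simp add: vec.span_subspace)
  obtain g where g: "Vector_Spaces.linear (*s) (*s) g" "\<forall>x\<in>B. g x = x" "range g = vec.span ((\<lambda>x. x) ` B)"
    using vec.linear_independent_extend_subspace[OF B(2), of "\<lambda>x. x"] by blast
  have "g v = v" if "v \<in> V" for v
    using vec.linear_eq_on[OF g(1) vec.linear_ident, of v B] g(2) that span by auto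
  moreover have "g v \<in> V" for v using g(3) span by auto
  moreover have "matrix g *v v = g v" for v by (rule matrix_works[OF g(1)])
  ultimately show ?thesis using that[of "matrix g"] by simp
qed

text \<open>
  A linear form on \<open>V\<close> is extended to the whole space by composing it with a projection onto \<open>V\<close>.
\<close>

lemma linear_forms_coordinates:
  assumes V: "vec.subspace V" and l: "l \<in> linear_forms V"
  obtains a where "\<And>v. v \<in> V \<Longrightarrow> l v = (\<Sum>i\<in>UNIV. a i * v $ i)"
proof -
  obtain M where M: "\<And>v. M *v v \<in> V" "\<And>v. v \<in> V \<Longrightarrow> M *v v = v"
    using linear_projection_matrix[OF V] by blast
  define a where "a i = l (M *v axis i 1)" for i
  have sum: "l (\<Sum>i\<in>I. c i *s (M *v axis i 1)) = (\<Sum>i\<in>I. c i * a i)" for c I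
  proof (induction I rule: infinite_finite_induct)
    case (insert i I)
    have "(\<Sum>i\<in>I. c i *s (M *v axis i 1)) \<in> V"
      using V M by (intro vec.subspace_sum vec.subspace_scale) auto
    then show ?case using insert V M l
      by (simp add: linear_forms_add linear_forms_scale vec.subspace_scale a_def)
  qed (use linear_forms_zero[OF l V] in auto)
  have "l v = (\<Sum>i\<in>UNIV. a i * v $ i)" if "v \<in> V" for v
  proof -
    have "v = M *v (\<Sum>i\<in>UNIV. v $ i *s axis i 1)" using M(2)[OF that] by (simp add: basis_expansion)
    also have "\<dots> = (\<Sum>i\<in>UNIV. v $ i *s (M *v axis i 1))"
      by (simp add: vec.linear_sum[OF matrix_vector_mul_linear_gen] vec.linear_scale[OF matrix_vector_mul_linear_gen])
    finally have "l v = l (\<Sum>i\<in>UNIV. v $ i *s (M *v axis i 1))" by simp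
    then show ?thesis by (simp add: sum mult.commute)
  qed
  then show ?thesis using that by blast
qed

definition poly_field :: "('k::field_char_0 ^ 'n) set \<Rightarrow> ('k ^ 'n \<Rightarrow> 'k ^ 'n) \<Rightarrow> bool" where
  "poly_field V w \<longleftrightarrow> (\<forall>i. (\<lambda>x. w x $ i) \<in> coord_ring V) \<and> (\<forall>x\<in>V. w x \<in> V)"

lemma poly_field_outside: "poly_field V w \<Longrightarrow> x \<notin> V \<Longrightarrow> w x = 0"
  using coord_ring_outside[of "\<lambda>x. w x $ _" V x] by (auto simp: poly_field_def vec_eq_iff)

lemma form_field_coord_ring:
  assumes V: "vec.subspace V" and l: "l \<in> linear_forms V" and w: "poly_field V w"
  shows "(\<lambda>x. if x \<in> V then l (w x) else 0) \<in> coord_ring V"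
proof -
  obtain a where a: "\<And>v. v \<in> V \<Longrightarrow> l v = (\<Sum>i\<in>UNIV. a i * v $ i)"
    using linear_forms_coordinates[OF V l] by blast
  have "(\<lambda>x. if x \<in> V then l (w x) else 0) = (\<Sum>i\<in>UNIV. (\<lambda>x. a i * w x $ i))"
    using w poly_field_outside[OF w] by (auto simp: fun_eq_iff fun_sum_apply poly_field_def a)
  moreover have "\<dots> \<in> coord_ring V"
    using w by (intro coord_ring_sum coord_ring_scale) (auto simp: poly_field_def)
  ultimately show ?thesis by simp
qed

lemma poly_field_sum:
  assumes V: "vec.subspace V"
    and "\<And>i. i \<in> I \<Longrightarrow> c i \<in> coord_ring V" "\<And>i. i \<in> I \<Longrightarrow> poly_field V (w i)"
  shows "poly_field V (\<lambda>x. \<Sum>i\<in>I. c i x *s w i x)"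
  unfolding poly_field_def
proof (intro conjI allI ballI)
  fix j
  have "(\<lambda>x. (\<Sum>i\<in>I. c i x *s w i x) $ j) = (\<Sum>i\<in>I. c i * (\<lambda>x. w i x $ j))"
    by (auto simp: fun_eq_iff fun_sum_apply)
  moreover have "\<dots> \<in> coord_ring V"
    using assms by (intro coord_ring_sum coord_ring.mult) (auto simp: poly_field_def)
  ultimately show "(\<lambda>x. (\<Sum>i\<in>I. c i x *s w i x) $ j) \<in> coord_ring V" by simp
next
  fix x assume "x \<in> V"
  then show "(\<Sum>i\<in>I. c i x *s w i x) \<in> V"
    using assms(2,3) V by (intro vec.subspace_sum vec.subspace_scale) (auto simp: poly_field_def)
qed

definition derivation_of :: "('k::field_char_0 ^ 'n) set \<Rightarrow> ('k ^ 'n \<Rightarrow> 'k ^ 'n) \<Rightarrow>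
    ('k ^ 'n \<Rightarrow> 'k) \<Rightarrow> ('k ^ 'n \<Rightarrow> 'k)" where
  "derivation_of V w f = (\<lambda>x. if f \<in> coord_ring V \<and> x \<in> V then dir_deriv f x (w x) else 0)"

lemma derivation_of_form:
  assumes "vec.subspace V" "poly_field V w" "l \<in> linear_forms V"
  shows "derivation_of V w l = (\<lambda>x. if x \<in> V then l (w x) else 0)"
  using assms dir_deriv_form[OF assms(1)]
  by (auto simp: derivation_of_def coord_ring.form poly_field_def)

lemma derivation_of_const:
  assumes "vec.subspace V" "poly_field V w"
  shows "derivation_of V w (const_on V a) = 0"
  using assms dir_deriv_const[OF assms(1)]
  by (auto simp: derivation_of_def coord_ring.const poly_field_def fun_eq_iff)

lemma derivation_of_add:
  assumes "vec.subspace V" "poly_field V w" "f \<in> coord_ring V" "g \<in> coord_ring V"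
  shows "derivation_of V w (f + g) = derivation_of V w f + derivation_of V w g"
proof
  fix x show "derivation_of V w (f + g) x = (derivation_of V w f + derivation_of V w g) x"
    using assms dir_deriv_add[OF assms(1) _ _ assms(3,4), of x "w x"] coord_ring.add[OF assms(3,4)]
    unfolding derivation_of_def poly_field_def plus_fun_apply by auto
qed

lemma derivation_of_mult:
  assumes "vec.subspace V" "poly_field V w" "f \<in> coord_ring V" "g \<in> coord_ring V"
  shows "derivation_of V w (f * g) = derivation_of V w f * g + f * derivation_of V w g"
proof
  fix x show "derivation_of V w (f * g) x = (derivation_of V w f * g + f * derivation_of V w g) x"
    using assms dir_deriv_mult[OF assms(1) _ _ assms(3,4), of x "w x"] coord_ring.mult[OF assms(3,4)]
    unfolding derivation_of_def poly_field_def plus_fun_apply times_fun_apply by auto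
qed

lemma derivation_of_derivation:
  assumes V: "vec.subspace V" and w: "poly_field V w"
  shows "derivation_of V w \<in> derivations V"
proof -
  have "derivation_of V w f \<in> coord_ring V" if "f \<in> coord_ring V" for f
    using that
  proof induction
    case (const a)
    show ?case unfolding derivation_of_const[OF V w] by (rule coord_ring_zero)
  next
    case (form l)
    show ?case unfolding derivation_of_form[OF V w form] by (rule form_field_coord_ring[OF V form w])
  next
    case (add f g)
    show ?case unfolding derivation_of_add[OF V w add.hyps] by (rule coord_ring.add[OF add.IH])
  next
    case (mult f g)
    show ?case unfolding derivation_of_mult[OF V w mult.hyps]
      by (intro coord_ring.add coord_ring.mult mult)
  qed
  moreover have "derivation_of V w f = 0" if "f \<notin> coord_ring V" for f
    using that by (auto simp: derivation_of_def)
  moreover have "derivation_of V w (const_on V a * f) = const_on V a * derivation_of V w f"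
    if "f \<in> coord_ring V" for a f
    unfolding derivation_of_mult[OF V w coord_ring.const that] derivation_of_const[OF V w] by simp
  ultimately show ?thesis
    using derivation_of_add[OF V w] derivation_of_mult[OF V w]
    unfolding derivations_def by blast
qed

lemma
  assumes "\<theta> \<in> derivations V" "f \<in> coord_ring V"
  shows derivation_add: "g \<in> coord_ring V \<Longrightarrow> \<theta> (f + g) = \<theta> f + \<theta> g"
    and derivation_mult: "g \<in> coord_ring V \<Longrightarrow> \<theta> (f * g) = \<theta> f * g + f * \<theta> g"
    and derivation_scale: "\<theta> (const_on V a * f) = const_on V a * \<theta> f"
  using assms unfolding derivations_def by blast+

lemma derivation_const:
  assumes \<theta>: "\<theta> \<in> derivations V"
  shows "\<theta> (const_on V a) = 0"
proof -
  have one: "const_on V 1 * f = f" if "f \<in> coord_ring V" for f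
    using coord_ring_outside[OF that] by (auto simp: const_on_def fun_eq_iff)
  have R: "const_on V 1 \<in> coord_ring V" "\<theta> (const_on V 1) \<in> coord_ring V"
    using \<theta> by (auto simp: derivations_def coord_ring.const)
  have "\<theta> (const_on V 1 * const_on V 1) = \<theta> (const_on V 1) * const_on V 1 + const_on V 1 * \<theta> (const_on V 1)"
    using \<theta> R unfolding derivations_def by blast
  then have "\<theta> (const_on V 1) = \<theta> (const_on V 1) + \<theta> (const_on V 1)"
    using one[OF R(1)] one[OF R(2)] by (metis mult.commute)
  then have "\<theta> (const_on V 1) = 0" by (metis add_cancel_left_right)
  moreover have "const_on V a * const_on V 1 = const_on V a"
    by (auto simp: const_on_def)
  moreover have "\<theta> (const_on V a * const_on V 1) = const_on V a * \<theta> (const_on V 1)"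
    using \<theta> R unfolding derivations_def by blast
  ultimately show ?thesis by simp
qed

lemma derivation_zero: "\<theta> \<in> derivations V \<Longrightarrow> \<theta> 0 = 0"
proof -
  have "const_on V 0 = 0" by (auto simp: const_on_def)
  then show "\<theta> \<in> derivations V \<Longrightarrow> \<theta> 0 = 0"
    using derivation_const[of \<theta> V 0] by (simp only:)
qed

lemma derivation_eqI:
  assumes V: "vec.subspace V" and \<theta>: "\<theta> \<in> derivations V" "\<eta> \<in> derivations V"
    and eq: "\<And>i. \<theta> (coordinate V i) = \<eta> (coordinate V i)"
  shows "\<theta> = \<eta>"
proof
  fix f
  have coord: "coordinate V i \<in> coord_ring V" for i by (intro coord_ring.form coordinate_form V)
  show "\<theta> f = \<eta> f"
  proof (cases "f \<in> coord_ring V")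
    case True
    then show ?thesis
    proof induction
      case (const a)
      then show ?case using \<theta> by (simp add: derivation_const)
    next
      case (form l)
      obtain a where a: "\<And>v. v \<in> V \<Longrightarrow> l v = (\<Sum>i\<in>UNIV. a i * v $ i)"
        using linear_forms_coordinates[OF V form] by blast
      have l: "l = (\<Sum>i\<in>UNIV. const_on V (a i) * coordinate V i)"
      proof
        fix x
        show "l x = (\<Sum>i\<in>UNIV. const_on V (a i) * coordinate V i) x"
          using linear_forms_outside[OF form, of x]
          by (cases "x \<in> V") (auto simp: fun_sum_apply a const_on_def coordinate_def)
      qed
      have "\<theta> (\<Sum>i\<in>I. const_on V (a i) * coordinate V i) = \<eta> (\<Sum>i\<in>I. const_on V (a i) * coordinate V i)"
        if "finite I" for I
        using that
      proof (induction rule: finite_induct)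
        case empty
        show ?case by (simp only: sum.empty derivation_zero[OF \<theta>(1)] derivation_zero[OF \<theta>(2)])
      next
        case (insert i I)
        have R: "const_on V (a i) * coordinate V i \<in> coord_ring V"
          "(\<Sum>i\<in>I. const_on V (a i) * coordinate V i) \<in> coord_ring V"
          by (intro coord_ring_sum coord_ring.mult coord_ring.const coord)+
        show ?case
          unfolding sum.insert[OF insert.hyps] derivation_add[OF \<theta>(1) R] derivation_add[OF \<theta>(2) R] insert.IH
            derivation_scale[OF \<theta>(1) coord] derivation_scale[OF \<theta>(2) coord] eq ..
      qed
      then show ?case unfolding l by simp
    next
      case (add f g)
      show ?case
        unfolding derivation_add[OF \<theta>(1) add.hyps] derivation_add[OF \<theta>(2) add.hyps] add.IH ..
    next
      case (mult f g)
      show ?case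
        unfolding derivation_mult[OF \<theta>(1) mult.hyps] derivation_mult[OF \<theta>(2) mult.hyps] mult.IH ..
    qed
  qed (use \<theta> in \<open>auto simp: derivations_def\<close>)
qed

text \<open>
  The field is read off from the values of \<open>\<theta>\<close> on the coordinate functions.  Its values lie in \<open>V\<close>
  because the coordinate functions on \<open>V\<close> satisfy the linear relations given by a projection matrix
  onto \<open>V\<close>, and \<open>\<theta>\<close> respects these.
\<close>

lemma derivation_poly_field:
  assumes V: "vec.subspace V" and \<theta>: "\<theta> \<in> derivations V"
  obtains w where "poly_field V w" "\<theta> = derivation_of V w"
proof -
  define w where "w x = (\<chi> i. \<theta> (coordinate V i) x)" for x
  have coord: "coordinate V i \<in> coord_ring V" for i by (intro coord_ring.form coordinate_form V)
  obtain M where M: "\<And>v. M *v v \<in> V" "\<And>v. v \<in> V \<Longrightarrow> M *v v = v"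
    using linear_projection_matrix[OF V] by blast
  have R: "\<theta> f \<in> coord_ring V" if "f \<in> coord_ring V" for f
    using \<theta> that by (auto simp: derivations_def)
  have sum_rel: "\<theta> (\<Sum>j\<in>J. const_on V (a j) * coordinate V j) = (\<Sum>j\<in>J. const_on V (a j) * \<theta> (coordinate V j))"
    if "finite J" for a J
    using that
  proof (induction rule: finite_induct)
    case empty
    show ?case by (simp only: sum.empty derivation_zero[OF \<theta>])
  next
    case (insert i I)
    have I: "const_on V (a i) * coordinate V i \<in> coord_ring V"
      "(\<Sum>i\<in>I. const_on V (a i) * coordinate V i) \<in> coord_ring V"
      by (intro coord_ring_sum coord_ring.mult coord_ring.const coord)+
    show ?case
      unfolding sum.insert[OF insert.hyps] derivation_add[OF \<theta> I] insert.IH derivation_scale[OF \<theta> coord] ..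
  qed
  have coord_rel: "coordinate V i = (\<Sum>j\<in>UNIV. const_on V (M $ i $ j) * coordinate V j)" for i
  proof
    fix v show "coordinate V i v = (\<Sum>j\<in>UNIV. const_on V (M $ i $ j) * coordinate V j) v"
      using M(2)[of v] by (auto simp: fun_sum_apply coordinate_def const_on_def matrix_vector_mult_def vec_eq_iff)
  qed
  have rel: "\<theta> (coordinate V i) = (\<Sum>j\<in>UNIV. const_on V (M $ i $ j) * \<theta> (coordinate V j))" for i
    using arg_cong[OF coord_rel[of i], of \<theta>] sum_rel[OF finite[of UNIV]] by (rule trans)
  have "w x \<in> V" if "x \<in> V" for x
  proof -
    have "w x $ i = (M *v w x) $ i" for i
      using fun_cong[OF rel[of i], of x] that
      by (simp add: w_def fun_sum_apply const_on_def matrix_vector_mult_def)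
    then have "w x = M *v w x" by (simp add: vec_eq_iff)
    then show ?thesis using M(1) by metis
  qed
  then have w: "poly_field V w"
    using R[OF coord] by (simp add: poly_field_def w_def)
  have "\<theta> = derivation_of V w"
  proof (rule derivation_eqI[OF V \<theta> derivation_of_derivation[OF V w]])
    fix i
    show "\<theta> (coordinate V i) = derivation_of V w (coordinate V i)"
      unfolding derivation_of_form[OF V w coordinate_form[OF V]]
      using w coord_ring_outside[OF R[OF coord]] by (auto simp: fun_eq_iff w_def coordinate_def poly_field_def)
  qed
  then show ?thesis using that w by blast
qed

lemma derivation_of_inject:
  assumes V: "vec.subspace V" and w: "poly_field V w" "poly_field V w'"
    and eq: "derivation_of V w = derivation_of V w'"
  shows "w = w'"
proof
  fix x
  show "w x = w' x"
  proof (cases "x \<in> V")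
    case True
    have "w x $ i = w' x $ i" for i
      using fun_cong[OF fun_cong[OF eq, of "coordinate V i"], of x] True w
      unfolding derivation_of_form[OF V w(1) coordinate_form[OF V]] derivation_of_form[OF V w(2) coordinate_form[OF V]]
      by (simp add: coordinate_def poly_field_def)
    then show ?thesis by (simp add: vec_eq_iff)
  qed (use poly_field_outside w in metis)
qed

lemma dir_deriv_linear:
  assumes V: "vec.subspace V" and f: "f \<in> coord_ring V" and x: "x \<in> V" and "\<And>i. i \<in> I \<Longrightarrow> v i \<in> V"
  shows "dir_deriv f x (\<Sum>i\<in>I. c i *s v i) = (\<Sum>i\<in>I. c i * dir_deriv f x (v i))"
proof -
  have mem: "(\<Sum>i\<in>I. c i *s v i) \<in> V" using assms by (intro vec.subspace_sum vec.subspace_scale) auto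
  show ?thesis using f
  proof induction
    case (const a)
    then show ?case using assms mem by (simp add: dir_deriv_const[OF V x])
  next
    case (form l)
    have "l (\<Sum>i\<in>I. c i *s v i) = (\<Sum>i\<in>I. c i * l (v i))"
      using assms(4)
    proof (induction I rule: infinite_finite_induct)
      case (insert i I)
      then have "(\<Sum>i\<in>I. c i *s v i) \<in> V" using V by (intro vec.subspace_sum vec.subspace_scale) auto
      then show ?case using insert form V by (simp add: linear_forms_add linear_forms_scale vec.subspace_scale)
    qed (use linear_forms_zero[OF form V] in auto)
    then show ?case using assms mem form by (simp add: dir_deriv_form[OF V x])
  next
    case (add f g)
    have "dir_deriv (f + g) x (\<Sum>i\<in>I. c i *s v i) = (\<Sum>i\<in>I. c i * dir_deriv f x (v i)) + (\<Sum>i\<in>I. c i * dir_deriv g x (v i))"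
      by (simp only: dir_deriv_add[OF V x mem add.hyps] add.IH)
    also have "\<dots> = (\<Sum>i\<in>I. c i * (dir_deriv f x (v i) + dir_deriv g x (v i)))"
      by (simp add: sum.distrib distrib_left)
    also have "\<dots> = (\<Sum>i\<in>I. c i * dir_deriv (f + g) x (v i))"
      by (intro sum.cong refl) (simp only: dir_deriv_add[OF V x assms(4) add.hyps])
    finally show ?case .
  next
    case (mult f g)
    have "dir_deriv (f * g) x (\<Sum>i\<in>I. c i *s v i) = (\<Sum>i\<in>I. c i * dir_deriv f x (v i)) * g x + f x * (\<Sum>i\<in>I. c i * dir_deriv g x (v i))"
      by (simp only: dir_deriv_mult[OF V x mem mult.hyps] mult.IH)
    also have "\<dots> = (\<Sum>i\<in>I. c i * (dir_deriv f x (v i) * g x + f x * dir_deriv g x (v i)))"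
      by (simp add: sum.distrib distrib_left sum_distrib_left sum_distrib_right mult_ac)
    also have "\<dots> = (\<Sum>i\<in>I. c i * dir_deriv (f * g) x (v i))"
      by (intro sum.cong refl) (simp only: dir_deriv_mult[OF V x assms(4) mult.hyps])
    finally show ?case .
  qed
qed

lemma derivation_of_sum:
  assumes V: "vec.subspace V" and "\<And>i. i \<in> I \<Longrightarrow> c i \<in> coord_ring V"
    and w: "\<And>i. i \<in> I \<Longrightarrow> poly_field V (w i)"
  shows "derivation_of V (\<lambda>x. \<Sum>i\<in>I. c i x *s w i x) f = (\<Sum>i\<in>I. c i * derivation_of V (w i) f)"
proof
  fix x
  show "derivation_of V (\<lambda>x. \<Sum>i\<in>I. c i x *s w i x) f x = (\<Sum>i\<in>I. c i * derivation_of V (w i) f) x"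
    using dir_deriv_linear[OF V, of f x I "\<lambda>i. w i x" "\<lambda>i. c i x"] w
    by (auto simp: derivation_of_def fun_sum_apply poly_field_def)
qed

section \<open>Hyperplanes and linear forms\<close>

lemma hyperplane_kernel:
  assumes V: "vec.subspace V" and l: "l \<in> linear_forms V" "\<exists>v\<in>V. l v \<noteq> 0"
  shows "hyperplane_of V {v\<in>V. l v = 0}"
proof -
  let ?H = "{v\<in>V. l v = 0}"
  have H: "vec.subspace ?H" by (rule subspace_kernel[OF V l(1)])
  obtain v where v: "v \<in> V" "l v \<noteq> 0" using l by blast
  obtain B where B: "B \<subseteq> ?H" "vec.independent B" "?H \<subseteq> vec.span B" "card B = vec.dim ?H"
    by (rule vec.basis_exists)
  have span: "vec.span B = ?H" using B H by (intro vec.span_subspace) auto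
  have indep: "vec.independent (insert v B)"
    using B(2) v span by (intro vec.independent_insertI) auto
  have "x \<in> vec.span (insert v B)" if "x \<in> V" for x
  proof -
    have "x - (l x / l v) *s v \<in> ?H"
      using that v V l by (auto simp: linear_forms_diff_scaled vec.subspace_diff vec.subspace_scale)
    then have "x - (l x / l v) *s v \<in> vec.span B" using span by simp
    then show ?thesis by (auto simp: vec.span_insert)
  qed
  moreover have "vec.span (insert v B) \<subseteq> V"
    using B v V by (intro vec.span_minimal) auto
  ultimately have "vec.dim V = card (insert v B)"
    using B v indep by (intro vec.basis_card_eq_dim[symmetric]) auto
  moreover have "finite B" using B(2) by (rule vec.finiteI_independent)
  moreover have "v \<notin> B" using B v by auto
  ultimately show ?thesis using H B by (auto simp: hyperplane_of_def)
qed

lemma hyperplane_form: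
  assumes V: "vec.subspace V" and H: "hyperplane_of V H"
  shows "\<exists>l. l \<in> linear_forms V \<and> {v\<in>V. l v = 0} = H"
proof -
  have Hs: "vec.subspace H" "H \<subseteq> V" "vec.dim V = vec.dim H + 1" using H by (auto simp: hyperplane_of_def)
  obtain v where v: "v \<in> V" "v \<notin> H" using Hs by (metis Suc_eq_plus1 n_not_Suc_n subsetI subset_antisym)
  obtain B where B: "B \<subseteq> H" "vec.independent B" "H \<subseteq> vec.span B" "card B = vec.dim H"
    by (rule vec.basis_exists)
  have span: "vec.span B = H" using B Hs by (intro vec.span_subspace) auto
  have vB: "v \<notin> B" "finite B" using v B vec.finiteI_independent by auto
  have indep: "vec.independent (insert v B)"
    using B(2) v span by (intro vec.independent_insertI) auto
  have "V \<subseteq> vec.span (insert v B)"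
    using indep vB B Hs v by (intro vec.card_ge_dim_independent) auto
  have e: "(axis undefined 1 :: 'a ^ 'b) $ undefined = 1" by (simp add: axis_def)
  obtain g :: "'a ^ 'b \<Rightarrow> 'a ^ 'b" where g: "Vector_Spaces.linear (*s) (*s) g"
    "\<forall>x\<in>insert v B. g x = (if x = v then axis undefined 1 else 0)"
    using vec.linear_independent_extend[OF indep, of "\<lambda>x. if x = v then axis undefined 1 else 0"] by blast
  have gB: "g b = 0" if "b \<in> B" for b using g(2) that vB by auto
  have gH: "g x = 0" if "x \<in> H" for x
    using vec.linear_eq_on[OF g(1) vec.module_hom_zero, of x B] gB span that by auto
  define l where "l x = (if x \<in> V then g x $ undefined else 0)" for x
  have "l \<in> linear_forms V"
    using vec.subspace_add[OF V] vec.subspace_scale[OF V]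
    by (auto simp: linear_forms_def l_def vec.linear_add[OF g(1)] vec.linear_scale[OF g(1)])
  moreover have "{x\<in>V. l x = 0} = H"
  proof (intro equalityI subsetI)
    fix x assume x: "x \<in> {x\<in>V. l x = 0}"
    then obtain k where k: "x - k *s v \<in> vec.span B"
      using \<open>V \<subseteq> vec.span (insert v B)\<close> by (auto simp: vec.span_insert)
    then have "g (x - k *s v) = 0" using gH span by simp
    then have "g x = k *s axis undefined 1"
      using g(2) by (simp add: vec.linear_diff[OF g(1)] vec.linear_scale[OF g(1)])
    then have "g x $ undefined = k" using e by simp
    moreover have "g x $ undefined = 0" using x by (simp add: l_def split: if_splits)
    ultimately have "k = 0" by simp
    then show "x \<in> H" using k span by simp
  qed (use gH Hs in \<open>auto simp: l_def\<close>)
  ultimately show ?thesis by blast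
qed

lemma
  assumes "vec.subspace V" "hyperplane_of V H"
  shows form_of_form: "form_of V H \<in> linear_forms V"
    and form_of_kernel: "{v\<in>V. form_of V H v = 0} = H"
  using someI_ex[OF hyperplane_form[OF assms]] by (auto simp: form_of_def)

lemma form_of_zero_iff:
  assumes "vec.subspace V" "hyperplane_of V H" "v \<in> V"
  shows "form_of V H v = 0 \<longleftrightarrow> v \<in> H"
  using form_of_kernel[OF assms(1,2)] assms(3) by blast

lemma hyperplane_subset_eq:
  assumes "hyperplane_of V H" "hyperplane_of V K" "H \<subseteq> K"
  shows "H = K"
  using assms by (intro vec.subspace_dim_equal) (auto simp: hyperplane_of_def)

lemma hyperplane_psubset: "hyperplane_of V H \<Longrightarrow> \<exists>v\<in>V. v \<notin> H"
  by (metis Suc_eq_plus1 hyperplane_of_def n_not_Suc_n subsetI subset_antisym)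

lemma form_of_nonzero_on:
  assumes "vec.subspace V" "hyperplane_of V H" "hyperplane_of V K" "H \<noteq> K"
  shows "\<exists>v\<in>H. form_of V K v \<noteq> 0"
proof -
  obtain v where "v \<in> H" "v \<notin> K" using hyperplane_subset_eq[OF assms(2,3)] assms(4) by blast
  moreover have "v \<in> V" using calculation assms(2) by (auto simp: hyperplane_of_def)
  ultimately show ?thesis using form_of_zero_iff[OF assms(1,3)] by blast
qed

lemma arrangement_restriction:
  assumes A: "arrangement V A" and H: "hyperplane_of V H" "H \<notin> A"
  shows "arrangement H ((\<lambda>K. H \<inter> K) ` A)"
proof -
  have V: "vec.subspace V" and Hs: "vec.subspace H" "H \<subseteq> V"
    using A H by (auto simp: arrangement_def hyperplane_of_def)
  have "hyperplane_of H (H \<inter> K)" if K: "K \<in> A" for K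
  proof -
    have KV: "hyperplane_of V K" "H \<noteq> K" using A K H by (auto simp: arrangement_def)
    define l where "l v = (if v \<in> H then form_of V K v else 0)" for v
    have "l \<in> linear_forms H"
      unfolding l_def using linear_forms_restrict[OF Hs form_of_form[OF V KV(1)]] by simp
    moreover have "\<exists>v\<in>H. l v \<noteq> 0"
      using form_of_nonzero_on[OF V H(1) KV] by (auto simp: l_def)
    ultimately have "hyperplane_of H {v\<in>H. l v = 0}" by (rule hyperplane_kernel[OF Hs(1)])
    moreover have "{v\<in>H. l v = 0} = H \<inter> K"
      using form_of_zero_iff[OF V KV(1)] Hs by (auto simp: l_def)
    ultimately show ?thesis by simp
  qed
  then show ?thesis using A Hs by (auto simp: arrangement_def)
qed

section \<open>The module of derivations as tangent fields\<close>

definition tangent_fields :: "('k::field_char_0 ^ 'n) set \<Rightarrow> ('k ^ 'n) set set \<Rightarrow> ('k ^ 'n \<Rightarrow> 'k ^ 'n) set" where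
  "tangent_fields V A = {w. poly_field V w \<and> (\<forall>H\<in>A. \<forall>x\<in>H. w x \<in> H)}"

lemma derivation_prod_dvd:
  assumes V: "vec.subspace V" and \<theta>: "\<theta> \<in> derivations V" and "finite S"
    and "\<And>s. s \<in> S \<Longrightarrow> l s \<in> coord_ring V"
    and "\<And>s. s \<in> S \<Longrightarrow> \<exists>g\<in>coord_ring V. \<theta> (l s) = l s * g"
  shows "\<exists>g\<in>coord_ring V. \<theta> (const_on V 1 * (\<Prod>s\<in>S. l s)) = (const_on V 1 * (\<Prod>s\<in>S. l s)) * g"
  using assms(3-5)
proof (induction rule: finite_induct)
  case empty
  show ?case
    by (rule bexI[OF _ coord_ring_zero]) (simp only: prod.empty mult_1_right mult_zero_right derivation_const[OF \<theta>])
next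
  case (insert s S)
  let ?q = "const_on V 1 * (\<Prod>s\<in>S. l s)"
  have q: "?q \<in> coord_ring V"
    using coord_ring_prod_mult[of S l V "const_on V 1"] insert.prems by (simp add: coord_ring.const mult.commute)
  have ls: "l s \<in> coord_ring V" using insert.prems by simp
  have "\<exists>g\<in>coord_ring V. \<theta> ?q = ?q * g" by (intro insert.IH insert.prems) auto
  then obtain g where g: "g \<in> coord_ring V" "\<theta> ?q = ?q * g" by blast
  obtain h where h: "h \<in> coord_ring V" "\<theta> (l s) = l s * h" using insert.prems(2)[of s] by blast
  have eq: "const_on V 1 * (\<Prod>s\<in>insert s S. l s) = l s * ?q"
    by (simp only: prod.insert[OF insert.hyps] mult_ac)
  have "\<theta> (l s * ?q) = (l s * ?q) * (h + g)"
    unfolding derivation_mult[OF \<theta> ls q] g(2) h(2) by (simp only: distrib_left distrib_right mult_ac)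
  then show ?case unfolding eq using coord_ring.add[OF h(1) g(1)] by blast
qed

text \<open>
  If \<open>\<theta>\<close> maps every \<open>\<alpha>\<^sub>H\<close> to a multiple of itself, then it does so with the product \<open>Q\<close> by the
  product rule.  Conversely, write \<open>Q = \<alpha>\<^sub>H q\<close>.  If \<open>Q\<close> divides \<open>\<theta> Q = (\<theta> \<alpha>\<^sub>H) q + \<alpha>\<^sub>H (\<theta> q)\<close>,
  then \<open>(\<theta> \<alpha>\<^sub>H) q\<close> vanishes on \<open>H\<close>, whereas \<open>q\<close> does not; so \<open>\<theta> \<alpha>\<^sub>H = \<alpha>\<^sub>H(w)\<close> vanishes on \<open>H\<close>.
\<close>

lemma derivation_module_iff:
  assumes A: "arrangement V A" and w: "poly_field V w"
  shows "derivation_of V w \<in> derivation_module V A \<longleftrightarrow> w \<in> tangent_fields V A"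
proof -
  have V: "vec.subspace V" and fin: "finite A" and hyp: "\<And>H. H \<in> A \<Longrightarrow> hyperplane_of V H"
    using A by (auto simp: arrangement_def)
  let ?\<theta> = "derivation_of V w"
  have \<theta>: "?\<theta> \<in> derivations V" by (rule derivation_of_derivation[OF V w])
  have l: "form_of V H \<in> linear_forms V" if "H \<in> A" for H by (rule form_of_form[OF V hyp[OF that]])
  have lR: "form_of V H \<in> coord_ring V" if "H \<in> A" for H using l[OF that] by (rule coord_ring.form)
  have \<theta>l: "?\<theta> (form_of V H) = (\<lambda>x. if x \<in> V then form_of V H (w x) else 0)" if "H \<in> A" for H
    by (rule derivation_of_form[OF V w l[OF that]])
  show ?thesis
  proof
    assume tangent: "w \<in> tangent_fields V A"
    have "\<exists>g\<in>coord_ring V. ?\<theta> (form_of V H) = form_of V H * g" if H: "H \<in> A" for H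
    proof (rule coord_ring_factor[OF V l[OF H]])
      show "?\<theta> (form_of V H) \<in> coord_ring V" using \<theta> lR[OF H] by (auto simp: derivations_def)
      show "?\<theta> (form_of V H) x = 0" if "x \<in> V" "form_of V H x = 0" for x
      proof -
        have "x \<in> H" using that form_of_zero_iff[OF V hyp[OF H]] by blast
        then have "w x \<in> H" using tangent H by (auto simp: tangent_fields_def)
        then show ?thesis
          using that hyp[OF H] form_of_zero_iff[OF V hyp[OF H], of "w x"]
          by (auto simp: \<theta>l[OF H] hyperplane_of_def)
      qed
    qed
    then have "\<exists>g\<in>coord_ring V. ?\<theta> (defining_poly V A) = defining_poly V A * g"
      unfolding defining_poly_def using derivation_prod_dvd[OF V \<theta> fin, of "form_of V"] lR by blast
    then show "?\<theta> \<in> derivation_module V A" using \<theta> by (simp add: derivation_module_def)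
  next
    assume "?\<theta> \<in> derivation_module V A"
    then obtain g where g: "g \<in> coord_ring V" "?\<theta> (defining_poly V A) = defining_poly V A * g"
      by (auto simp: derivation_module_def)
    have "w x \<in> H" if H: "H \<in> A" and x: "x \<in> H" for H x
    proof -
      have Hs: "vec.subspace H" "H \<subseteq> V" using hyp[OF H] by (auto simp: hyperplane_of_def)
      let ?q = "const_on V 1 * (\<Prod>K\<in>A - {H}. form_of V K)"
      have q: "?q \<in> coord_ring V"
        using coord_ring_prod_mult[of "A - {H}" "form_of V" V "const_on V 1"] lR
        by (simp add: coord_ring.const mult.commute)
      have Q: "defining_poly V A = form_of V H * ?q"
        unfolding defining_poly_def prod.remove[OF fin H] by (simp only: mult_ac)
      have \<theta>lR: "?\<theta> (form_of V H) \<in> coord_ring V" using \<theta> lR[OF H] by (auto simp: derivations_def)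
      have eq: "?\<theta> (form_of V H) * ?q + form_of V H * ?\<theta> ?q = (form_of V H * ?q) * g"
        using g(2) unfolding Q derivation_mult[OF \<theta> lR[OF H] q] .
      have "?\<theta> (form_of V H) y * ?q y = 0" if "y \<in> H" for y
      proof -
        have "form_of V H y = 0" using that Hs form_of_zero_iff[OF V hyp[OF H]] by blast
        then show ?thesis using fun_cong[OF eq, of y] by simp
      qed
      then have "(\<forall>y\<in>H. ?\<theta> (form_of V H) y = 0) \<or> (\<forall>y\<in>H. ?q y = 0)"
        by (rule coord_ring_domain[OF V Hs \<theta>lR q])
      moreover have "\<exists>y\<in>H. \<forall>K\<in>A - {H}. form_of V K y \<noteq> 0"
        using lR form_of_nonzero_on[OF V hyp[OF H] hyp] fin
        by (intro coord_ring_nonvanishing[OF V Hs]) auto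
      then have "\<exists>y\<in>H. ?q y \<noteq> 0"
        using fin Hs by (auto simp: const_on_def fun_prod_apply)
      ultimately have "?\<theta> (form_of V H) x = 0" using x by blast
      then have "form_of V H (w x) = 0"
        using x Hs by (auto simp: \<theta>l[OF H])
      then show ?thesis
        using form_of_zero_iff[OF V hyp[OF H], of "w x"] x Hs w by (auto simp: poly_field_def)
    qed
    then show "w \<in> tangent_fields V A" using w by (auto simp: tangent_fields_def)
  qed
qed

section \<open>Free arrangements in terms of vector fields\<close>

definition homogeneous_field :: "('k::field_char_0 ^ 'n) set \<Rightarrow> nat \<Rightarrow> ('k ^ 'n \<Rightarrow> 'k ^ 'n) \<Rightarrow> bool" where
  "homogeneous_field V d w \<longleftrightarrow> (\<forall>t. \<forall>x\<in>V. w (t *s x) = t ^ d *s w x)"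

text \<open>
  The basis is indexed by an arbitrary finite set so that the basis elements of bounded degree can be
  treated as a subfamily.
\<close>

definition tangent_basis :: "('k::field_char_0 ^ 'n) set \<Rightarrow> ('k ^ 'n) set set \<Rightarrow> 'i set \<Rightarrow>
    ('i \<Rightarrow> 'k ^ 'n \<Rightarrow> 'k ^ 'n) \<Rightarrow> ('i \<Rightarrow> nat) \<Rightarrow> bool" where
  "tangent_basis V A I w d \<longleftrightarrow> finite I \<and>
     (\<forall>i\<in>I. w i \<in> tangent_fields V A \<and> homogeneous_field V (d i) (w i)) \<and>
     (\<forall>u\<in>tangent_fields V A. \<exists>c. (\<forall>i\<in>I. c i \<in> coord_ring V) \<and> u = (\<lambda>x. \<Sum>i\<in>I. c i x *s w i x)) \<and>
     (\<forall>c. (\<forall>i\<in>I. c i \<in> coord_ring V) \<and> (\<forall>x. (\<Sum>i\<in>I. c i x *s w i x) = 0) \<longrightarrow> (\<forall>i\<in>I. c i = 0))"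

definition free_with :: "('k::field_char_0 ^ 'n) set \<Rightarrow> ('k ^ 'n) set set \<Rightarrow> nat multiset \<Rightarrow> bool" where
  "free_with V A E \<longleftrightarrow> (\<exists>(I :: nat set) w d. tangent_basis V A I w d \<and> E = image_mset d (mset_set I))"

lemma tangent_basis_poly_field: "tangent_basis V A I w d \<Longrightarrow> i \<in> I \<Longrightarrow> poly_field V (w i)"
  by (auto simp: tangent_basis_def tangent_fields_def)

lemma tangent_basis_finite: "tangent_basis V A I w d \<Longrightarrow> finite I"
  and tangent_basis_tangent: "tangent_basis V A I w d \<Longrightarrow> i \<in> I \<Longrightarrow> w i \<in> tangent_fields V A"
  and tangent_basis_homogeneous: "tangent_basis V A I w d \<Longrightarrow> i \<in> I \<Longrightarrow> homogeneous_field V (d i) (w i)"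
  by (auto simp: tangent_basis_def)

lemma tangent_basis_span:
  assumes "tangent_basis V A I w d" "u \<in> tangent_fields V A"
  obtains c where "\<And>i. i \<in> I \<Longrightarrow> c i \<in> coord_ring V" "u = (\<lambda>x. \<Sum>i\<in>I. c i x *s w i x)"
  using assms unfolding tangent_basis_def by blast

lemma tangent_basis_indep:
  assumes "tangent_basis V A I w d" "\<And>i. i \<in> I \<Longrightarrow> c i \<in> coord_ring V"
    and "\<And>x. (\<Sum>i\<in>I. c i x *s w i x) = 0"
  shows "\<forall>i\<in>I. c i = 0"
proof -
  have "\<forall>c. (\<forall>i\<in>I. c i \<in> coord_ring V) \<and> (\<forall>x. (\<Sum>i\<in>I. c i x *s w i x) = 0) \<longrightarrow> (\<forall>i\<in>I. c i = 0)"
    using assms(1) unfolding tangent_basis_def by (elim conjE)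
  from spec[OF this, of c] show ?thesis using assms(2,3) by blast
qed

lemma tangent_basis_unique:
  assumes "tangent_basis V A I w d" "\<And>i. i \<in> I \<Longrightarrow> c i \<in> coord_ring V" "\<And>i. i \<in> I \<Longrightarrow> c' i \<in> coord_ring V"
    and eq: "\<And>x. x \<in> V \<Longrightarrow> (\<Sum>i\<in>I. c i x *s w i x) = (\<Sum>i\<in>I. c' i x *s w i x)" and "i \<in> I"
  shows "c i = c' i"
proof -
  have "(\<Sum>i\<in>I. (c i - c' i) x *s w i x) = 0" for x
  proof (cases "x \<in> V")
    case True
    then show ?thesis using eq[OF True] by (simp add: vec.scale_left_diff_distrib sum_subtractf)
  next
    case False
    then have "(c i - c' i) x *s w i x = 0" if "i \<in> I" for i
      using poly_field_outside[OF tangent_basis_poly_field[OF assms(1) that]] by simp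
    then show ?thesis by (simp add: sum.neutral)
  qed
  then have "\<forall>i\<in>I. c i - c' i = 0"
    by (intro tangent_basis_indep[OF assms(1)]) (use assms(2,3) coord_ring_diff in blast)+
  then show ?thesis using \<open>i \<in> I\<close> by (metis eq_iff_diff_eq_0)
qed

text \<open>
  A change of language: the derivations of the basis fields, listed in some order, form a homogeneous
  basis of the module of derivations.
\<close>

lemma exponents_of_tangent_basis:
  assumes A: "arrangement V A" and basis: "tangent_basis V A I w d"
  shows "exponents V A (image_mset d (mset_set I))"
proof -
  have V: "vec.subspace V" using A by (simp add: arrangement_def)
  have "finite I" using basis by (simp add: tangent_basis_def)
  then obtain ks where ks: "set ks = I" "distinct ks" using finite_distinct_list by blast
  define n where "n = length ks"
  have bij: "bij_betw (\<lambda>k. ks ! k) {..<n} I"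
    using ks by (auto simp: n_def bij_betw_def inj_on_nth image_def in_set_conv_nth)
  have isI: "ks ! k \<in> I" if "k < n" for k using that ks by (auto simp: n_def)
  have w: "poly_field V (w i)" if "i \<in> I" for i using tangent_basis_poly_field[OF basis that] .
  let ?\<theta>s = "map (\<lambda>i. derivation_of V (w i)) ks"
  have sum_list_index: "(\<Sum>k<length ?\<theta>s. cs ! k * (?\<theta>s ! k) f)
      = derivation_of V (\<lambda>x. \<Sum>k<n. (cs ! k) x *s w (ks ! k) x) f"
    if "length cs = n" "set cs \<subseteq> coord_ring V" for cs f
    using that w isI by (subst derivation_of_sum[OF V]) (auto simp: n_def subset_iff)
  have "module_basis V A ?\<theta>s"
    unfolding module_basis_def
  proof (intro conjI ballI)
    show "set ?\<theta>s \<subseteq> derivation_module V A"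
      using ks basis derivation_module_iff[OF A w] by (auto simp: tangent_basis_def)
  next
    fix \<eta> assume \<eta>: "\<eta> \<in> derivation_module V A"
    then obtain u where u: "poly_field V u" "\<eta> = derivation_of V u"
      using derivation_poly_field[OF V, of \<eta>] by (auto simp: derivation_module_def)
    then have "u \<in> tangent_fields V A" using \<eta> derivation_module_iff[OF A u(1)] by simp
    then obtain c where c: "\<And>i. i \<in> I \<Longrightarrow> c i \<in> coord_ring V" "u = (\<lambda>x. \<Sum>i\<in>I. c i x *s w i x)"
      using tangent_basis_span[OF basis] by blast
    show "\<exists>!cs. length cs = length ?\<theta>s \<and> set cs \<subseteq> coord_ring V \<and>
        (\<forall>f. \<eta> f = (\<Sum>i<length ?\<theta>s. cs ! i * (?\<theta>s ! i) f))"
    proof (rule ex1I)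
      have cs: "length (map c ks) = n" "set (map c ks) \<subseteq> coord_ring V" using c ks by (auto simp: n_def)
      have "u = (\<lambda>x. \<Sum>k<n. (map c ks ! k) x *s w (ks ! k) x)"
        unfolding c(2) sum.reindex_bij_betw[OF bij, symmetric] by (simp add: n_def)
      then show "length (map c ks) = length ?\<theta>s \<and> set (map c ks) \<subseteq> coord_ring V \<and>
          (\<forall>f. \<eta> f = (\<Sum>i<length ?\<theta>s. map c ks ! i * (?\<theta>s ! i) f))"
        unfolding sum_list_index[OF cs] u(2) using cs by (simp add: n_def)
    next
      fix cs assume cs: "length cs = length ?\<theta>s \<and> set cs \<subseteq> coord_ring V \<and>
          (\<forall>f. \<eta> f = (\<Sum>i<length ?\<theta>s. cs ! i * (?\<theta>s ! i) f))"
      then have cs': "length cs = n" "set cs \<subseteq> coord_ring V" by (auto simp: n_def)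
      define v where "v x = (\<Sum>k<n. (cs ! k) x *s w (ks ! k) x)" for x
      have csR: "cs ! k \<in> coord_ring V" if "k < n" for k using cs' that by auto
      have "poly_field V v"
        unfolding v_def using w isI csR by (intro poly_field_sum[OF V]) auto
      moreover have "derivation_of V u = derivation_of V v"
        using cs unfolding sum_list_index[OF cs'] u(2) v_def by auto
      ultimately have uv: "u = v" using derivation_of_inject[OF V u(1)] by blast
      define k where "k = inv_into {..<n} (\<lambda>k. ks ! k)"
      have k: "k i < n" "ks ! k i = i" if "i \<in> I" for i
        using that bij_betw_inv_into_right[OF bij that] bij_betw_apply[OF bij_betw_inv_into[OF bij] that]
        by (auto simp: k_def)
      have k': "k (ks ! m) = m" if "m < n" for m
        using bij_betw_inv_into_left[OF bij, of m] that by (simp add: k_def)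
      have "v x = (\<Sum>i\<in>I. (cs ! k i) x *s w i x)" for x
        unfolding v_def sum.reindex_bij_betw[OF bij, symmetric] by (simp add: k')
      then have "(\<Sum>i\<in>I. c i x *s w i x) = (\<Sum>i\<in>I. (cs ! k i) x *s w i x)" for x
        using fun_cong[OF uv, of x] by (simp add: c(2))
      then have "c i = cs ! k i" if "i \<in> I" for i
        using csR k c(1) that by (intro tangent_basis_unique[OF basis, where c = c and c' = "\<lambda>i. cs ! k i"]) auto
      then show "cs = map c ks"
        using cs' isI k' by (intro nth_equalityI) (auto simp: n_def)
    qed
  qed
  moreover have "has_pdeg V (derivation_of V (w i)) (d i)" if "i \<in> I" for i
    unfolding has_pdeg_def
  proof
    fix l assume l: "l \<in> linear_forms V"
    show "homogeneous V (d i) (derivation_of V (w i) l)"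
      unfolding derivation_of_form[OF V w[OF that] l]
    proof (rule homogeneousI[OF V form_field_coord_ring[OF V l w[OF that]]])
      fix t x assume x: "x \<in> V"
      then have "w i (t *s x) = t ^ d i *s w i x" "w i x \<in> V" "t *s x \<in> V"
        using basis that V w[OF that] by (auto simp: tangent_basis_def homogeneous_field_def poly_field_def vec.subspace_scale)
      then show "(if t *s x \<in> V then l (w i (t *s x)) else 0) = t ^ d i * (if x \<in> V then l (w i x) else 0)"
        using x l by (simp add: linear_forms_scale)
    qed
  qed
  then have "list_all2 (has_pdeg V) ?\<theta>s (map d ks)"
    using ks by (auto simp: list_all2_conv_all_nth)
  moreover have "image_mset d (mset_set I) = mset (map d ks)"
    using ks by (simp add: mset_set_set [symmetric] flip: ks(1))
  ultimately show ?thesis unfolding exponents_def by blast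
qed

lemma free_with_exponents: "arrangement V A \<Longrightarrow> free_with V A E \<Longrightarrow> exponents V A E"
  unfolding free_with_def using exponents_of_tangent_basis by metis

text \<open>
  The constant fields with values in a basis of \<open>V\<close> form a basis; the coefficients of a field are
  its coordinates with respect to that basis of \<open>V\<close>.
\<close>

lemma free_with_empty:
  assumes V: "vec.subspace V"
  shows "free_with V {} (replicate_mset (vec.dim V) 0)"
proof -
  obtain B where B: "B \<subseteq> V" "vec.independent B" "V \<subseteq> vec.span B" "card B = vec.dim V"
    by (rule vec.basis_exists[of V])
  have fin: "finite B" using B(2) by (rule vec.finiteI_independent)
  define n where "n = vec.dim V"
  obtain b where b: "bij_betw b {..<n} B"
    using ex_bij_betw_nat_finite[OF fin] B(4) by (auto simp: n_def atLeast0LessThan)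
  have bV: "b i \<in> V" if "i < n" for i using b B that by (auto simp: bij_betw_def)
  have span: "vec.span B = V" using B V by (intro vec.span_subspace)
  define w where "w i x = (if x \<in> V then b i else 0)" for i x
  have w: "poly_field V (w i)" if "i < n" for i
  proof -
    have "(\<lambda>x. w i x $ j) = const_on V (b i $ j)" for j by (auto simp: w_def const_on_def)
    then show ?thesis using bV[OF that] by (simp add: poly_field_def coord_ring.const w_def)
  qed
  define r where "r i = (\<lambda>v. if v \<in> V then vec.representation B v (b i) else 0)" for i
  have r: "r i \<in> linear_forms V" for i
    unfolding linear_forms_def r_def using V span B(2)
    by (auto simp: vec.representation_add vec.representation_scale vec.subspace_add vec.subspace_scale)
  have expand: "v = (\<Sum>i<n. r i v *s b i)" if "v \<in> V" for v
  proof -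
    have "v = (\<Sum>x\<in>B. vec.representation B v x *s x)"
      using vec.sum_representation_eq[OF B(2), of v B] that span fin by simp
    also have "\<dots> = (\<Sum>i<n. vec.representation B v (b i) *s b i)"
      by (rule sum.reindex_bij_betw[OF b, symmetric])
    finally show ?thesis using that by (simp add: r_def)
  qed
  have "tangent_basis V {} {..<n} w (\<lambda>_. 0)"
    unfolding tangent_basis_def
  proof (intro conjI ballI allI impI)
    fix u assume u: "u \<in> tangent_fields V {}"
    then have uf: "poly_field V u" by (simp add: tangent_fields_def)
    show "\<exists>c. (\<forall>i\<in>{..<n}. c i \<in> coord_ring V) \<and> u = (\<lambda>x. \<Sum>i<n. c i x *s w i x)"
    proof (intro exI conjI ballI)
      show "(\<lambda>x. if x \<in> V then r i (u x) else 0) \<in> coord_ring V" for i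
        by (rule form_field_coord_ring[OF V r uf])
      show "u = (\<lambda>x. \<Sum>i<n. (if x \<in> V then r i (u x) else 0) *s w i x)"
      proof
        fix x show "u x = (\<Sum>i<n. (if x \<in> V then r i (u x) else 0) *s w i x)"
          using expand[of "u x"] uf poly_field_outside[OF uf, of x]
          by (cases "x \<in> V") (auto simp: w_def poly_field_def)
      qed
    qed
  next
    fix c i assume c: "(\<forall>i\<in>{..<n}. c i \<in> coord_ring V) \<and> (\<forall>x. (\<Sum>i<n. c i x *s w i x) = 0)" and i: "i \<in> {..<n}"
    have "c i x = 0" if "x \<in> V" for x
    proof -
      have "(\<Sum>v\<in>B. c (inv_into {..<n} b v) x *s v) = (\<Sum>j<n. c (inv_into {..<n} b (b j)) x *s b j)"
        by (rule sum.reindex_bij_betw[OF b, symmetric])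
      also have "\<dots> = (\<Sum>j<n. c j x *s b j)"
        using bij_betw_inv_into_left[OF b] by (intro sum.cong) auto
      also have "\<dots> = (\<Sum>j<n. c j x *s w j x)" using that by (simp add: w_def)
      also have "\<dots> = 0" using c by blast
      finally have "\<forall>v\<in>B. c (inv_into {..<n} b v) x = 0"
        using vec.independentD[OF B(2) fin order_refl, of "\<lambda>v. c (inv_into {..<n} b v) x"] by simp
      then show ?thesis using i b bij_betw_inv_into_left[OF b, of i] by (auto simp: bij_betw_def)
    qed
    then show "c i = 0" using c i coord_ring_outside[of "c i" V] by (metis ext zero_fun_apply)
  qed (use w V in \<open>auto simp: tangent_fields_def homogeneous_field_def w_def vec.subspace_scale\<close>)
  moreover have "replicate_mset n 0 = image_mset (\<lambda>_. 0 :: nat) (mset_set {..<n})"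
    by (simp add: image_mset_const_eq)
  ultimately show ?thesis unfolding free_with_def n_def by blast
qed

section \<open>More rows than columns over a domain\<close>

text \<open>
  Fraction-free Gaussian elimination, with a row whose entry in the column \<open>j0\<close> is nonzero as pivot.
\<close>

lemma dependent_rows:
  fixes S :: "'a::comm_ring_1 set" and M :: "'i \<Rightarrow> 'j \<Rightarrow> 'a"
  assumes S: "0 \<in> S" "\<And>a b. a \<in> S \<Longrightarrow> b \<in> S \<Longrightarrow> a - b \<in> S" "\<And>a b. a \<in> S \<Longrightarrow> b \<in> S \<Longrightarrow> a * b \<in> S"
    and dom: "\<And>a b. a \<in> S \<Longrightarrow> b \<in> S \<Longrightarrow> a * b = 0 \<Longrightarrow> a = 0 \<or> b = 0" and "\<exists>e\<in>S. e \<noteq> 0"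
    and "finite J" "finite I" "card J < card I" "\<And>i j. i \<in> I \<Longrightarrow> j \<in> J \<Longrightarrow> M i j \<in> S"
  shows "\<exists>c. (\<forall>i\<in>I. c i \<in> S) \<and> (\<exists>i\<in>I. c i \<noteq> 0) \<and> (\<forall>j\<in>J. (\<Sum>i\<in>I. c i * M i j) = 0)"
  using assms(6-9)
proof (induction J arbitrary: I M rule: finite_induct)
  case empty
  obtain e where "e \<in> S" "e \<noteq> 0" using assms(5) by blast
  then show ?case using empty by (intro exI[of _ "\<lambda>_. e"]) (auto simp: card_gt_0_iff)
next
  case (insert j0 J)
  have uminus: "- a \<in> S" if "a \<in> S" for a using S(2)[OF S(1) that] by simp
  have add: "a + b \<in> S" if "a \<in> S" "b \<in> S" for a b using S(2)[OF that(1) uminus[OF that(2)]] by simp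
  have sum: "(\<Sum>i\<in>K. f i) \<in> S" if "\<And>i. i \<in> K \<Longrightarrow> f i \<in> S" for f and K :: "'i set"
    using that by (induction K rule: infinite_finite_induct) (auto simp: S add)
  show ?case
  proof (cases "\<forall>i\<in>I. M i j0 = 0")
    case True
    have "\<exists>c. (\<forall>i\<in>I. c i \<in> S) \<and> (\<exists>i\<in>I. c i \<noteq> 0) \<and> (\<forall>j\<in>J. (\<Sum>i\<in>I. c i * M i j) = 0)"
      using insert.hyps insert.prems by (intro insert.IH) auto
    then show ?thesis using True by auto
  next
    case False
    then obtain k where k: "k \<in> I" "M k j0 \<noteq> 0" by blast
    let ?p = "M k j0" and ?I = "I - {k}"
    \<comment> \<open>Cross-multiplying with the pivot clears column \<open>j0\<close> without division.\<close>
    define N where "N i j = ?p * M i j - M i j0 * M k j" for i j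
    have p: "?p \<in> S" using k insert.prems by auto
    have MS: "M i j \<in> S" if "i \<in> I" "j \<in> insert j0 J" for i j using insert.prems that by blast
    have "\<exists>c. (\<forall>i\<in>?I. c i \<in> S) \<and> (\<exists>i\<in>?I. c i \<noteq> 0) \<and> (\<forall>j\<in>J. (\<Sum>i\<in>?I. c i * N i j) = 0)"
    proof (rule insert.IH)
      show "card J < card ?I" using insert.hyps insert.prems k by simp
      show "N i j \<in> S" if "i \<in> ?I" "j \<in> J" for i j
        unfolding N_def using that k by (intro S(2,3) MS) auto
    qed (use insert.prems in auto)
    then obtain c where c: "\<forall>i\<in>?I. c i \<in> S" "\<exists>i\<in>?I. c i \<noteq> 0" "\<forall>j\<in>J. (\<Sum>i\<in>?I. c i * N i j) = 0"
      by blast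
    define c' where "c' i = (if i = k then - (\<Sum>i\<in>?I. c i * M i j0) else ?p * c i)" for i
    have split: "(\<Sum>i\<in>I. c' i * M i j) = (\<Sum>i\<in>?I. c i * N i j)" for j
    proof -
      have "(\<Sum>i\<in>I. c' i * M i j) = c' k * M k j + (\<Sum>i\<in>?I. c' i * M i j)"
        using k insert.prems by (simp add: sum.remove)
      also have "(\<Sum>i\<in>?I. c' i * M i j) = (\<Sum>i\<in>?I. ?p * c i * M i j)"
        by (intro sum.cong) (auto simp: c'_def)
      also have "c' k * M k j = - (\<Sum>i\<in>?I. c i * M i j0 * M k j)"
        by (simp add: c'_def sum_distrib_right)
      finally show ?thesis
        by (simp add: N_def right_diff_distrib sum_subtractf mult_ac)
    qed
    have "N i j0 = 0" for i by (simp add: N_def mult.commute)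
    then have "\<forall>j\<in>insert j0 J. (\<Sum>i\<in>I. c' i * M i j) = 0" using c(3) by (simp add: split)
    moreover have "\<forall>i\<in>I. c' i \<in> S"
      using c(1) p k by (auto simp: c'_def intro!: uminus sum S(3) MS)
    moreover have "\<exists>i\<in>I. c' i \<noteq> 0"
    proof -
      obtain i where i: "i \<in> ?I" "c i \<noteq> 0" using c(2) by blast
      then have "?p * c i \<noteq> 0" using dom[OF p, of "c i"] k c(1) by blast
      then show ?thesis using i by (auto simp: c'_def)
    qed
    ultimately show ?thesis by blast
  qed
qed

section \<open>Values of tangent fields on a new hyperplane\<close>

lemma tangent_fields_sum:
  assumes A: "arrangement V A" and c: "\<And>i. i \<in> I \<Longrightarrow> c i \<in> coord_ring V"
    and w: "\<And>i. i \<in> I \<Longrightarrow> w i \<in> tangent_fields V A"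
  shows "(\<lambda>x. \<Sum>i\<in>I. c i x *s w i x) \<in> tangent_fields V A"
proof -
  have V: "vec.subspace V" using A by (simp add: arrangement_def)
  have "(\<Sum>i\<in>I. c i x *s w i x) \<in> H" if "H \<in> A" "x \<in> H" for H x
  proof -
    have "vec.subspace H" using A that by (auto simp: arrangement_def hyperplane_of_def)
    then show ?thesis
      using w that by (intro vec.subspace_sum vec.subspace_scale) (auto simp: tangent_fields_def)
  qed
  then show ?thesis
    using poly_field_sum[OF V, of I c w] c w by (auto simp: tangent_fields_def)
qed

lemma forms_proportional:
  assumes K: "vec.subspace K" "K \<subseteq> V" and V: "vec.subspace V"
    and a: "a \<in> linear_forms V" and l: "l \<in> linear_forms V"
    and y: "y \<in> K" "a y \<noteq> 0" and ker: "\<And>x. x \<in> K \<Longrightarrow> a x = 0 \<Longrightarrow> l x = 0"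
  obtains s where "\<And>x. x \<in> K \<Longrightarrow> l x = s * a x"
proof
  fix x assume x: "x \<in> K"
  have mem: "x - (a x / a y) *s y \<in> K" "x \<in> V" "y \<in> V"
    using K x y by (auto simp: vec.subspace_diff vec.subspace_scale)
  have "a (x - (a x / a y) *s y) = 0"
    using mem a V y by (simp add: linear_forms_diff_scaled)
  then have "l (x - (a x / a y) *s y) = 0" using ker mem by blast
  then show "l x = (l y / a y) * a x"
    using mem l V y by (simp add: linear_forms_diff_scaled)
qed

lemma homogeneous_prod_power:
  assumes "\<And>s. s \<in> S \<Longrightarrow> homogeneous V 1 (l s)"
  shows "homogeneous V (\<Sum>s\<in>S. m s) ((\<Prod>s\<in>S. l s ^ m s) * const_on V 1)"
proof -
  have power: "homogeneous V (m + d) (l ^ m * f)" if "homogeneous V 1 l" "homogeneous V d f" for l f m d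
  proof (induction m)
    case (Suc m)
    have "homogeneous V (1 + (m + d)) (l * (l ^ m * f))" by (rule homogeneous.mult[OF that(1) Suc])
    then show ?case by (simp only: power_Suc mult.assoc add_Suc plus_1_eq_Suc)
  qed (use that in simp)
  show ?thesis using assms
  proof (induction S rule: infinite_finite_induct)
    case (insert s S)
    have "homogeneous V (\<Sum>s\<in>S. m s) ((\<Prod>s\<in>S. l s ^ m s) * const_on V 1)"
      by (rule insert.IH) (rule insert.prems, rule insertI2)
    then have "homogeneous V (m s + (\<Sum>s\<in>S. m s)) (l s ^ m s * ((\<Prod>s\<in>S. l s ^ m s) * const_on V 1))"
      by (rule power[OF insert.prems[OF insertI1]])
    then show ?case by (simp only: sum.insert[OF insert.hyps] prod.insert[OF insert.hyps] mult.assoc)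
  qed (simp_all add: homogeneous.const)
qed

locale hyperplane_addition =
  fixes V H :: "('k::field_char_0 ^ 'n) set" and A
  assumes arrangement: "arrangement V A" and hyperplane: "hyperplane_of V H" and new: "H \<notin> A"
begin

abbreviation \<alpha> where "\<alpha> \<equiv> form_of V H"
abbreviation restriction where "restriction \<equiv> (\<lambda>K. H \<inter> K) ` A"

lemma subspace_V: "vec.subspace V" and finite_A: "finite A" and subspace_H: "vec.subspace H" "H \<subseteq> V"
  and hyperplane_A: "\<And>K. K \<in> A \<Longrightarrow> hyperplane_of V K"
  and subspace_A: "\<And>K. K \<in> A \<Longrightarrow> vec.subspace K" "\<And>K. K \<in> A \<Longrightarrow> K \<subseteq> V"
  using arrangement hyperplane by (auto simp: arrangement_def hyperplane_of_def)

lemma form_\<alpha>: "\<alpha> \<in> linear_forms V" by (rule form_of_form[OF subspace_V hyperplane])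

lemma \<alpha>_zero_iff: "x \<in> V \<Longrightarrow> \<alpha> x = 0 \<longleftrightarrow> x \<in> H" by (rule form_of_zero_iff[OF subspace_V hyperplane])

lemma \<alpha>_zero: "x \<in> H \<Longrightarrow> \<alpha> x = 0" using \<alpha>_zero_iff subspace_H by blast

lemma form_nonzero_on:
  assumes "K \<in> A" shows "\<exists>x\<in>H. form_of V K x \<noteq> 0" "\<exists>x\<in>K. \<alpha> x \<noteq> 0"
  using form_of_nonzero_on[OF subspace_V hyperplane hyperplane_A[OF assms]]
    form_of_nonzero_on[OF subspace_V hyperplane_A[OF assms] hyperplane] new assms by auto

lemma restriction_arrangement: "arrangement H restriction"
  by (rule arrangement_restriction[OF arrangement hyperplane new])

lemma insert_arrangement: "arrangement V (insert H A)"
  using arrangement hyperplane by (auto simp: arrangement_def)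

text \<open>
  Let \<open>\<alpha>\<^sub>0\<close> be the form of \<open>K0\<close> and put \<open>h = \<alpha> \<alpha>\<^sub>0(w) - \<alpha>\<^sub>0 \<alpha>(w)\<close>.  On each \<open>K\<close> that meets \<open>H\<close> in
  the same subspace as \<open>K0\<close>, the forms \<open>\<alpha>\<close> and \<open>\<alpha>\<^sub>0\<close> are proportional, and \<open>w\<close> preserves \<open>K\<close>; so \<open>h\<close>
  vanishes there.  Hence \<open>h\<close> is divisible by the product of the forms of all these \<open>K\<close>.  Restricted
  to \<open>H\<close> this product is a constant multiple of \<open>\<alpha>\<^sub>0 ^ card S\<close>, while \<open>h\<close> becomes \<open>- \<alpha>\<^sub>0 \<alpha>(w)\<close>.
\<close>

lemma form_value_dvd_power:
  assumes w: "w \<in> tangent_fields V A" and K0: "K0 \<in> A"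
  defines "S \<equiv> {K\<in>A. H \<inter> K = H \<inter> K0}"
  shows "\<exists>u\<in>coord_ring H. (\<lambda>x. if x \<in> H then \<alpha> (w x) else 0)
    = (\<lambda>x. if x \<in> H then form_of V K0 x else 0) ^ (card S - 1) * u"
proof -
  let ?l = "form_of V K0" and ?\<beta> = "\<lambda>x. if x \<in> H then form_of V K0 x else 0"
  let ?g = "\<lambda>x. if x \<in> H then \<alpha> (w x) else 0"
  have wf: "poly_field V w" using w by (simp add: tangent_fields_def)
  have l: "form_of V K \<in> linear_forms V" if "K \<in> A" for K
    by (rule form_of_form[OF subspace_V hyperplane_A[OF that]])
  define f where "f m = (\<lambda>x. if x \<in> V then m (w x) else 0)" for m :: "'k ^ 'n \<Rightarrow> 'k"
  have f: "f m \<in> coord_ring V" if "m \<in> linear_forms V" for m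
    unfolding f_def by (rule form_field_coord_ring[OF subspace_V that wf])
  \<comment> \<open>Vanishes on all members of \<open>S\<close>, and is \<open>- \<alpha>\<^sub>0 \<alpha>(w)\<close> on \<open>H\<close>.\<close>
  define h where "h = \<alpha> * f ?l - ?l * f \<alpha>"
  have hR: "h \<in> coord_ring V"
    unfolding h_def by (intro coord_ring_diff coord_ring.mult f coord_ring.form form_\<alpha> l K0)
  have h_zero: "h x = 0" if K: "K \<in> S" and x: "x \<in> K" for K x
  proof -
    have KA: "K \<in> A" and HK: "H \<inter> K = H \<inter> K0" using K by (auto simp: S_def)
    obtain y where y: "y \<in> K" "\<alpha> y \<noteq> 0" using form_nonzero_on[OF KA] by blast
    have "?l z = 0" if "z \<in> K" "\<alpha> z = 0" for z
    proof -
      have "z \<in> H \<inter> K" using that \<alpha>_zero_iff subspace_A[OF KA] by blast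
      then show ?thesis using HK form_of_zero_iff[OF subspace_V hyperplane_A[OF K0], of z] subspace_H by blast
    qed
    then obtain s where s: "\<And>z. z \<in> K \<Longrightarrow> ?l z = s * \<alpha> z"
      using forms_proportional[OF subspace_A[OF KA] subspace_V form_\<alpha> l[OF K0] y] by blast
    have "w x \<in> K" "x \<in> V" using w KA x subspace_A[OF KA] by (auto simp: tangent_fields_def)
    then show ?thesis using s x by (simp add: h_def f_def)
  qed
  have "\<exists>u\<in>coord_ring V. h = (\<Prod>K\<in>S. form_of V K ^ 1) * u"
  proof (rule coord_ring_prod_dvd[OF subspace_V _ _ _ _ hR])
    show "finite S" using finite_A by (simp add: S_def)
    fix K assume K: "K \<in> S"
    then have KA: "K \<in> A" by (simp add: S_def)
    show "form_of V K \<in> linear_forms V" by (rule l[OF KA])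
    show "\<exists>x\<in>V. form_of V K x \<noteq> 0" using form_nonzero_on[OF KA] subspace_H by blast
    show "\<exists>x\<in>V. form_of V L x = 0 \<and> form_of V K x \<noteq> 0" if "L \<in> S" "K \<noteq> L" for L
    proof -
      have "L \<in> A" using that by (simp add: S_def)
      then show ?thesis
        using form_of_nonzero_on[OF subspace_V hyperplane_A hyperplane_A[OF KA]] that
          form_of_zero_iff[OF subspace_V hyperplane_A[OF \<open>L \<in> A\<close>]] subspace_A[OF \<open>L \<in> A\<close>] by (metis subsetD)
    qed
    show "\<exists>g\<in>coord_ring V. h = form_of V K ^ 1 * g"
      using coord_ring_factor[OF subspace_V l[OF KA] hR] h_zero[OF K] form_of_zero_iff[OF subspace_V hyperplane_A[OF KA]]
      by (simp only: power_one_right)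
  qed
  then obtain u where u: "u \<in> coord_ring V" "h = (\<Prod>K\<in>S. form_of V K) * u" by auto
  have "\<exists>s. \<forall>x\<in>H. form_of V K x = s * ?l x" if K: "K \<in> S" for K
  proof -
    have KA: "K \<in> A" and HK: "H \<inter> K = H \<inter> K0" using K by (auto simp: S_def)
    obtain y where y: "y \<in> H" "?l y \<noteq> 0" using form_nonzero_on[OF K0] by blast
    have "form_of V K z = 0" if "z \<in> H" "?l z = 0" for z
    proof -
      have "z \<in> H \<inter> K0" using that form_of_zero_iff[OF subspace_V hyperplane_A[OF K0], of z] subspace_H by blast
      then show ?thesis using HK form_of_zero_iff[OF subspace_V hyperplane_A[OF KA], of z] subspace_H by blast
    qed
    then show ?thesis
      using forms_proportional[OF subspace_H subspace_V l[OF K0] l[OF KA] y] by metis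
  qed
  then obtain s where s: "\<And>K x. K \<in> S \<Longrightarrow> x \<in> H \<Longrightarrow> form_of V K x = s K * ?l x" by metis
  define u' where "u' = (\<lambda>x. if x \<in> H then - prod s S * u x else 0)"
  have u': "u' \<in> coord_ring H"
    using coord_ring_restrict[OF subspace_H coord_ring_scale[OF u(1), of "- prod s S"]] by (simp add: u'_def)
  have "finite S" "K0 \<in> S" using finite_A K0 by (auto simp: S_def)
  then have "card S > 0" by (auto simp: card_gt_0_iff)
  then have card: "card S = Suc (card S - 1)" by simp
  have \<beta>: "?\<beta> \<in> linear_forms H" by (rule linear_forms_restrict[OF subspace_H l[OF K0]])
  have g: "?g \<in> coord_ring H"
  proof -
    have "?g = (\<lambda>x. if x \<in> H then f \<alpha> x else 0)" using subsetD[OF subspace_H(2)] by (simp add: f_def fun_eq_iff)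
    then show ?thesis using coord_ring_restrict[OF subspace_H f[OF form_\<alpha>]] by simp
  qed
  have "?g = ?\<beta> ^ (card S - 1) * u'"
  proof (rule coord_ring_cancel[OF subspace_H(1)])
    show "?\<beta> * ?g = ?\<beta> * (?\<beta> ^ (card S - 1) * u')"
    proof
      fix x
      show "(?\<beta> * ?g) x = (?\<beta> * (?\<beta> ^ (card S - 1) * u')) x"
      proof (cases "x \<in> H")
        case True
        then have "h x = - (?l x * \<alpha> (w x))" using \<alpha>_zero subspace_H by (auto simp: h_def f_def)
        moreover have "h x = prod s S * ?l x ^ card S * u x"
          unfolding u(2) using True by (simp add: fun_prod_apply s prod.distrib)
        ultimately have "?l x * \<alpha> (w x) = ?l x ^ Suc (card S - 1) * (- prod s S * u x)"
          using card by (simp add: mult_ac minus_equation_iff[of "_ * _"])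
        then show ?thesis using True by (simp add: fun_power_apply u'_def)
      qed simp
    qed
    show "?\<beta> \<in> coord_ring H" using \<beta> by (rule coord_ring.form)
    show "?\<beta> ^ (card S - 1) * u' \<in> coord_ring H"
      by (intro coord_ring_power_mult coord_ring.form \<beta> u')
    obtain y where "y \<in> H" "?l y \<noteq> 0" using form_nonzero_on[OF K0] by blast
    then show "?\<beta> \<noteq> 0" by (auto simp: fun_eq_iff)
  qed (rule g)
  then show ?thesis using u' by blast
qed

text \<open>
  The form \<open>B\<close> is the product over the hyperplanes \<open>X\<close> of the restriction of \<open>\<beta>\<^sub>X ^ (m\<^sub>X - 1)\<close>, where
  \<open>\<beta>\<^sub>X\<close> defines \<open>X\<close> in \<open>H\<close> and \<open>m\<^sub>X\<close> is the number of hyperplanes \<open>K\<close> in \<open>A\<close> with \<open>H \<inter> K = X\<close>.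
  Since the \<open>m\<^sub>X\<close> add up to \<open>card A\<close>, its degree is \<open>card A\<close> minus the size of the restriction.
\<close>

lemma form_value_factor:
  assumes card: "card A = card restriction + b"
  obtains B where "homogeneous H b B" "\<exists>x\<in>H. B x \<noteq> 0"
    "\<And>w. w \<in> tangent_fields V A \<Longrightarrow> \<exists>c\<in>coord_ring H. \<forall>x\<in>H. \<alpha> (w x) = B x * c x"
proof -
  \<comment> \<open>A hyperplane of \<open>A\<close> that cuts out \<open>X\<close> in \<open>H\<close>; the restriction of its form defines \<open>X\<close>.\<close>
  define \<kappa> where "\<kappa> X = (SOME K. K \<in> A \<and> H \<inter> K = X)" for X
  have \<kappa>: "\<kappa> X \<in> A" "H \<inter> \<kappa> X = X" if "X \<in> restriction" for X
    using someI_ex[of "\<lambda>K. K \<in> A \<and> H \<inter> K = X"] that by (auto simp: \<kappa>_def)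
  define \<beta> where "\<beta> X = (\<lambda>x. if x \<in> H then form_of V (\<kappa> X) x else 0)" for X
  define m where "m X = card {K\<in>A. H \<inter> K = X} - 1" for X
  let ?B = "(\<Prod>X\<in>restriction. \<beta> X ^ m X) * const_on H 1"
  have fin: "finite restriction" using finite_A by simp
  have \<beta>: "\<beta> X \<in> linear_forms H" if "X \<in> restriction" for X
    unfolding \<beta>_def
    by (rule linear_forms_restrict[OF subspace_H form_of_form[OF subspace_V hyperplane_A[OF \<kappa>(1)[OF that]]]])
  have \<beta>_zero: "\<beta> X x = 0 \<longleftrightarrow> x \<in> X" if "X \<in> restriction" "x \<in> H" for X x
    using form_of_zero_iff[OF subspace_V hyperplane_A[OF \<kappa>(1)[OF that(1)]], of x] \<kappa>(2)[OF that(1)] that(2) subspace_H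
    by (auto simp: \<beta>_def)
  have \<beta>_nonzero: "\<exists>x\<in>H. \<beta> X x \<noteq> 0" if "X \<in> restriction" for X
    using form_nonzero_on(1)[OF \<kappa>(1)[OF that]] by (auto simp: \<beta>_def)
  have "(\<Sum>X\<in>restriction. m X) = b"
  proof -
    have "card A = (\<Sum>X\<in>restriction. card {K\<in>A. H \<inter> K = X})"
      using sum.image_gen[OF finite_A, of "\<lambda>_. 1 :: nat" "\<lambda>K. H \<inter> K"] by simp
    also have "\<dots> = (\<Sum>X\<in>restriction. m X + 1)"
    proof (rule sum.cong)
      fix X assume "X \<in> restriction"
      then have "card {K\<in>A. H \<inter> K = X} > 0" using \<kappa> finite_A by (auto simp: card_gt_0_iff)
      then show "card {K\<in>A. H \<inter> K = X} = m X + 1" by (simp add: m_def)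
    qed simp
    also have "\<dots> = (\<Sum>X\<in>restriction. m X) + card restriction" by (subst sum.distrib) simp
    finally show ?thesis using card by simp
  qed
  then have "homogeneous H b ?B"
    using homogeneous_prod_power[of restriction H \<beta> m] \<beta> homogeneous.form by blast
  moreover have "\<exists>x\<in>H. ?B x \<noteq> 0"
  proof -
    obtain x where "x \<in> H" "\<forall>X\<in>restriction. \<beta> X x \<noteq> 0"
      using coord_ring_nonvanishing[OF subspace_H(1) subspace_H(1) order_refl fin, of \<beta>] \<beta> \<beta>_nonzero coord_ring.form by blast
    then show ?thesis
      using fin by (intro bexI[of _ x]) (auto simp: fun_prod_apply fun_power_apply const_on_def)
  qed
  moreover have "\<exists>c\<in>coord_ring H. \<forall>x\<in>H. \<alpha> (w x) = ?B x * c x" if w: "w \<in> tangent_fields V A" for w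
  proof -
    let ?g = "\<lambda>x. if x \<in> H then \<alpha> (w x) else 0"
    have dvd: "\<exists>u\<in>coord_ring H. ?g = \<beta> X ^ m X * u" if X: "X \<in> restriction" for X
      using form_value_dvd_power[OF w \<kappa>(1)[OF X]] unfolding \<kappa>(2)[OF X] \<beta>_def m_def .
    have g: "?g \<in> coord_ring H"
    proof -
      have "poly_field V w" using w by (simp add: tangent_fields_def)
      from coord_ring_restrict[OF subspace_H form_field_coord_ring[OF subspace_V form_\<alpha> this]]
      have "(\<lambda>x. if x \<in> H then if x \<in> V then \<alpha> (w x) else 0 else 0) \<in> coord_ring H" .
      moreover have "(\<lambda>x. if x \<in> H then if x \<in> V then \<alpha> (w x) else 0 else 0) = ?g"
        using subsetD[OF subspace_H(2)] by (simp add: fun_eq_iff)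
      ultimately show ?thesis by (simp only:)
    qed
    have "\<exists>u\<in>coord_ring H. ?g = (\<Prod>X\<in>restriction. \<beta> X ^ m X) * u"
    proof (rule coord_ring_prod_dvd[OF subspace_H(1) fin \<beta> \<beta>_nonzero _ g dvd])
      fix X Y assume XY: "X \<in> restriction" "Y \<in> restriction" "X \<noteq> Y"
      have "hyperplane_of H X" "hyperplane_of H Y"
        using restriction_arrangement XY by (auto simp: arrangement_def)
      then obtain x where x: "x \<in> Y" "x \<notin> X" using hyperplane_subset_eq XY(3) by blast
      then have "x \<in> H" using XY by blast
      then show "\<exists>x\<in>H. \<beta> Y x = 0 \<and> \<beta> X x \<noteq> 0" using \<beta>_zero XY x by blast
    qed
    then obtain u where u: "u \<in> coord_ring H" "?g = (\<Prod>X\<in>restriction. \<beta> X ^ m X) * u" by blast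
    have "\<alpha> (w x) = ?B x * u x" if "x \<in> H" for x
      using fun_cong[OF u(2), of x] that by (simp add: const_on_def)
    then show ?thesis using u(1) by blast
  qed
  ultimately show ?thesis using that by blast
qed

text \<open>
  Away from \<open>H\<close>, coordinatewise division by \<open>\<alpha>\<close> gives values in \<open>V\<close>; composing with a projection
  onto \<open>V\<close> ensures this on \<open>H\<close> as well.  The quotient is tangent to \<open>K\<close> because \<open>\<alpha>\<close> does not vanish identically on \<open>K\<close>.
\<close>

lemma divide_by_form:
  assumes u: "u \<in> tangent_fields V A" and zero: "\<And>x. x \<in> H \<Longrightarrow> u x = 0"
  obtains u' where "u' \<in> tangent_fields V A" "u = (\<lambda>x. \<alpha> x *s u' x)"
proof -
  have uf: "poly_field V u" using u by (simp add: tangent_fields_def)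
  obtain M where M: "\<And>v. M *v v \<in> V" "\<And>v. v \<in> V \<Longrightarrow> M *v v = v"
    using linear_projection_matrix[OF subspace_V] by blast
  have "\<exists>g\<in>coord_ring V. (\<lambda>x. u x $ i) = \<alpha> * g" for i
    using uf zero \<alpha>_zero_iff by (intro coord_ring_factor[OF subspace_V form_\<alpha>]) (auto simp: poly_field_def)
  then obtain g where g: "\<And>i. g i \<in> coord_ring V" "\<And>i. (\<lambda>x. u x $ i) = \<alpha> * g i" by metis
  define u' where "u' x = M *v (\<chi> i. g i x)" for x
  have comp: "(\<lambda>x. u' x $ i) = (\<Sum>j\<in>UNIV. (\<lambda>x. M $ i $ j * g j x))" for i
    by (auto simp: u'_def matrix_vector_mult_def fun_sum_apply)
  have u'f: "poly_field V u'"
    unfolding poly_field_def comp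
    using M(1) g(1) by (auto simp: u'_def intro!: coord_ring_sum coord_ring_scale)
  have eq: "u x = \<alpha> x *s u' x" for x
  proof (cases "x \<in> V")
    case True
    have "u x = \<alpha> x *s (\<chi> i. g i x)" using fun_cong[OF g(2), of x] by (simp add: vec_eq_iff)
    then have "M *v u x = \<alpha> x *s u' x" by (simp add: u'_def matrix_vector_mult_scaleR vec.scale)
    moreover have "M *v u x = u x" using M(2) uf True by (simp add: poly_field_def)
    ultimately show ?thesis by simp
  qed (simp add: poly_field_outside[OF uf] poly_field_outside[OF u'f])
  have "u' x \<in> K" if K: "K \<in> A" and x: "x \<in> K" for K x
  proof -
    let ?l = "form_of V K"
    have l: "?l \<in> linear_forms V" by (rule form_of_form[OF subspace_V hyperplane_A[OF K]])
    let ?f = "\<lambda>x. if x \<in> V then ?l (u' x) else 0"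
    have "\<alpha> y * ?f y = 0" if y: "y \<in> K" for y
    proof -
      have "y \<in> V" using y subspace_A[OF K] by blast
      have "u y \<in> K" using u K y by (auto simp: tangent_fields_def)
      then have "?l (u y) = 0"
        using form_of_zero_iff[OF subspace_V hyperplane_A[OF K]] subspace_A[OF K] by blast
      then show ?thesis using \<open>y \<in> V\<close> l u'f by (simp add: eq linear_forms_scale poly_field_def)
    qed
    then have "(\<forall>y\<in>K. \<alpha> y = 0) \<or> (\<forall>y\<in>K. ?f y = 0)"
      using coord_ring_domain[OF subspace_V subspace_A[OF K] coord_ring.form[OF form_\<alpha>] form_field_coord_ring[OF subspace_V l u'f]]
      by blast
    then have "?f x = 0" using form_nonzero_on[OF K] x by blast
    then show ?thesis
      using form_of_zero_iff[OF subspace_V hyperplane_A[OF K], of "u' x"] subspace_A[OF K] x u'f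
      by (auto simp: poly_field_def subset_iff)
  qed
  then have "u' \<in> tangent_fields V A" using u'f by (simp add: tangent_fields_def)
  then show ?thesis using that eq by blast
qed

lemma restrict_tangent:
  assumes w: "w \<in> tangent_fields V (insert H A)"
  shows "(\<lambda>x. if x \<in> H then w x else 0) \<in> tangent_fields H restriction"
proof -
  have "(\<lambda>x. (if x \<in> H then w x else 0) $ i) \<in> coord_ring H" for i
  proof -
    have "(\<lambda>x. (if x \<in> H then w x else 0) $ i) = (\<lambda>x. if x \<in> H then w x $ i else 0)" by auto
    then show ?thesis
      using coord_ring_restrict[OF subspace_H, of "\<lambda>x. w x $ i"] w by (simp add: tangent_fields_def poly_field_def)
  qed
  then show ?thesis using w by (auto simp: tangent_fields_def poly_field_def)
qed

lemma tangent_insert_iff: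
  "w \<in> tangent_fields V (insert H A) \<longleftrightarrow> w \<in> tangent_fields V A \<and> (\<forall>x\<in>H. \<alpha> (w x) = 0)"
  using \<alpha>_zero_iff \<alpha>_zero subspace_H by (auto simp: tangent_fields_def poly_field_def subset_iff)

text \<open>
  Composition with a linear retraction of \<open>V\<close> onto \<open>H\<close> lifts functions on \<open>H\<close> to functions on \<open>V\<close>.
\<close>

lemma retraction:
  obtains P where "\<And>x. x \<in> V \<Longrightarrow> P x \<in> H" "\<And>x. x \<in> H \<Longrightarrow> P x = x"
    "\<And>t x. x \<in> V \<Longrightarrow> P (t *s x) = t *s P x"
    "\<And>f. f \<in> coord_ring H \<Longrightarrow> (\<lambda>x. if x \<in> V then f (P x) else 0) \<in> coord_ring V"
proof -
  obtain v where v: "v \<in> V" "v \<notin> H" using hyperplane_psubset[OF hyperplane] by blast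
  define w where "w = (1 / \<alpha> v) *s v"
  have w: "w \<in> V" "\<alpha> w = 1"
    using v form_\<alpha> subspace_V \<alpha>_zero_iff by (auto simp: w_def vec.subspace_scale linear_forms_scale)
  define P where "P x = x - \<alpha> x *s w" for x
  have PH: "P x \<in> H" if "x \<in> V" for x
  proof -
    have "P x \<in> V" "\<alpha> (P x) = 0"
      using that w subspace_V form_\<alpha> by (auto simp: P_def vec.subspace_diff vec.subspace_scale linear_forms_diff_scaled)
    then show ?thesis using \<alpha>_zero_iff by blast
  qed
  show ?thesis
  proof (rule that[of P, OF PH])
    show "P x = x" if "x \<in> H" for x using that \<alpha>_zero by (simp add: P_def)
    show scale: "P (t *s x) = t *s P x" if "x \<in> V" for t x
      using that form_\<alpha> by (simp add: P_def linear_forms_scale vec.scale_right_diff_distrib)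
    have "P (x + y) = P x + P y" if "x \<in> V" "y \<in> V" for x y
      using that form_\<alpha> by (simp add: P_def linear_forms_add algebra_simps)
    then show "(\<lambda>x. if x \<in> V then f (P x) else 0) \<in> coord_ring V" if "f \<in> coord_ring H" for f
      using scale PH subspace_V that by (rule coord_ring_pullback[where W = H])
  qed auto
qed

end

section \<open>The addition theorem\<close>

text \<open>
  Comparing \<open>u(t x) = t^e u(x)\<close> with the expansions of both sides shows
  \<open>t^(\<delta> j) c\<^sub>j(t x) = t^e c\<^sub>j(x)\<close>, so that \<open>c\<^sub>j\<close> would have negative degree.
\<close>

lemma expansion_degree:
  assumes V: "vec.subspace V" and basis: "tangent_basis V A J \<eta> \<delta>"
    and c: "\<And>j. j \<in> J \<Longrightarrow> c j \<in> coord_ring V" and u: "homogeneous_field V e u"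
    and eq: "\<And>x. x \<in> V \<Longrightarrow> u x = (\<Sum>j\<in>J. c j x *s \<eta> j x)"
    and j: "j \<in> J" "e < \<delta> j"
  shows "c j = 0"
proof -
  have "c j x = 0" if x: "x \<in> V" for x
  proof (rule scaling_degree_zero[OF V c[OF j(1)] x j(2)])
    fix t
    have mem: "t *s y \<in> V" if "y \<in> V" for y using V that by (rule vec.subspace_scale)
    have "(\<lambda>x. t ^ \<delta> j * (if x \<in> V then c j (t *s x) else 0)) = (\<lambda>x. t ^ e * c j x)"
    proof (rule tangent_basis_unique[OF basis _ _ _ j(1)])
      fix i assume i: "i \<in> J"
      have "(\<lambda>x. if x \<in> V then c i (t *s x) else 0) \<in> coord_ring V"
        by (rule coord_ring_pullback[OF _ _ mem V c[OF i]])
          (simp_all add: vec.scale_right_distrib mult.commute)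
      then show "(\<lambda>x. t ^ \<delta> i * (if x \<in> V then c i (t *s x) else 0)) \<in> coord_ring V"
        by (rule coord_ring_scale)
      show "(\<lambda>x. t ^ e * c i x) \<in> coord_ring V" by (rule coord_ring_scale[OF c[OF i]])
    next
      fix y assume y: "y \<in> V"
      have "(\<Sum>i\<in>J. (t ^ \<delta> i * (if y \<in> V then c i (t *s y) else 0)) *s \<eta> i y)
          = (\<Sum>i\<in>J. c i (t *s y) *s \<eta> i (t *s y))"
        using y tangent_basis_homogeneous[OF basis]
        by (intro sum.cong) (simp_all add: homogeneous_field_def mult.commute)
      also have "\<dots> = u (t *s y)" by (simp only: eq[OF mem[OF y]])
      also have "\<dots> = t ^ e *s u y" using u y by (simp add: homogeneous_field_def)
      also have "\<dots> = (\<Sum>i\<in>J. (t ^ e * c i y) *s \<eta> i y)"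
        by (simp add: eq[OF y] vec.scale_sum_right)
      finally show "(\<Sum>i\<in>J. (t ^ \<delta> i * (if y \<in> V then c i (t *s y) else 0)) *s \<eta> i y)
          = (\<Sum>i\<in>J. (t ^ e * c i y) *s \<eta> i y)" .
    qed
    from fun_cong[OF this, of x] show "t ^ \<delta> j * c j (t *s x) = t ^ e * c j x" using x by simp
  qed
  then show ?thesis using c[OF j(1)] coord_ring_zero by (intro coord_ring_eqI) auto
qed

context hyperplane_addition
begin

text \<open>
  The scaling behaviour says that \<open>c\<close> is homogeneous of degree \<open>d - b\<close>, in a form that also makes sense
  for \<open>d < b\<close>.
\<close>

lemma coefficient_scaling:
  assumes B: "homogeneous H b B" "\<exists>x\<in>H. B x \<noteq> 0" and c: "c \<in> coord_ring H"
    and w: "poly_field V w" "homogeneous_field V d w" and eq: "\<And>x. x \<in> H \<Longrightarrow> \<alpha> (w x) = B x * c x" and x: "x \<in> H"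
  shows "t ^ b * c (t *s x) = t ^ d * c x"
proof -
  have mem: "t *s y \<in> H" if "y \<in> H" for y using subspace_H(1) that by (rule vec.subspace_scale)
  let ?f = "\<lambda>x. if x \<in> H then c (t *s x) else 0"
  have f: "?f \<in> coord_ring H"
    by (rule coord_ring_pullback[OF _ _ mem subspace_H(1) c]) (simp_all add: vec.scale_right_distrib mult.commute)
  let ?g = "(\<lambda>x. t ^ b * ?f x) - (\<lambda>x. t ^ d * c x)"
  have g: "?g \<in> coord_ring H" by (intro coord_ring_diff coord_ring_scale f c)
  have "B y * ?g y = 0" if y: "y \<in> H" for y
  proof -
    have "y \<in> V" using y subspace_H by blast
    then have "\<alpha> (w (t *s y)) = t ^ d * \<alpha> (w y)"
      using w form_\<alpha> by (simp add: homogeneous_field_def linear_forms_scale poly_field_def)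
    then have "B (t *s y) * c (t *s y) = t ^ d * (B y * c y)" by (simp only: eq mem y)
    then show ?thesis
      using y homogeneous_scaling[OF B(1) subspace_H(1) y, of t] by (simp add: algebra_simps)
  qed
  then have "\<forall>y\<in>H. ?g y = 0"
    using coord_ring_domain[OF subspace_H(1) subspace_H(1) order_refl homogeneous_coord_ring[OF B(1)] g] B(2) by blast
  then show ?thesis using x by auto
qed

text \<open>
  The coefficient \<open>c\<^sub>k\<close> is homogeneous of degree 0, hence a constant \<open>\<kappa>\<close>.  For \<open>i \<noteq> k\<close> the field
  \<open>w\<^sub>i - (c\<^sub>i / \<kappa>) w\<^sub>k\<close> is tangent to \<open>H\<close>, where \<open>c\<^sub>i\<close> is lifted to \<open>V\<close>; and so is \<open>\<alpha> w\<^sub>k\<close>.  A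
  field tangent to \<open>H\<close> is a combination of the corrected fields and \<open>w\<^sub>k\<close>, and evaluating \<open>\<alpha>\<close> on \<open>H\<close>
  shows that the coefficient of \<open>w\<^sub>k\<close> is divisible by \<open>\<alpha>\<close>.
\<close>

lemma exchange_basis:
  assumes basis: "tangent_basis V A I w d" and k: "k \<in> I" "d k = b"
    and B: "homogeneous H b B" "\<exists>x\<in>H. B x \<noteq> 0"
    and c: "\<And>i. i \<in> I \<Longrightarrow> c i \<in> coord_ring H" "\<And>i x. i \<in> I \<Longrightarrow> x \<in> H \<Longrightarrow> \<alpha> (w i x) = B x * c i x"
    and ck: "c k \<noteq> 0"
  shows "\<exists>w'. tangent_basis V (insert H A) I w' (d(k := Suc b))"
proof -
  have fin: "finite I" by (rule tangent_basis_finite[OF basis])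
  have wf: "poly_field V (w i)" and wt: "w i \<in> tangent_fields V A" and wh: "homogeneous_field V (d i) (w i)"
    if "i \<in> I" for i
    using that tangent_basis_poly_field[OF basis] tangent_basis_tangent[OF basis]
      tangent_basis_homogeneous[OF basis] by auto
  have scaling: "t ^ b * c i (t *s x) = t ^ d i * c i x" if "i \<in> I" "x \<in> H" for i x t
    using coefficient_scaling[OF B c(1) wf wh c(2)] that by blast
  define \<kappa> where "\<kappa> = c k 0"
  have ck_const: "c k x = \<kappa>" if "x \<in> H" for x
    using scaling_degree_eq[OF subspace_H(1) c(1)[OF k(1)] that, of b] scaling[OF k(1) that] k(2) by (simp add: \<kappa>_def)
  have \<kappa>: "\<kappa> \<noteq> 0"
  proof
    assume "\<kappa> = 0"
    then have "c k = 0"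
      using ck_const c(1)[OF k(1)] coord_ring_zero by (intro coord_ring_eqI[of _ H]) auto
    then show False using ck by simp
  qed
  obtain P where P: "\<And>x. x \<in> V \<Longrightarrow> P x \<in> H" "\<And>x. x \<in> H \<Longrightarrow> P x = x"
    "\<And>t x. x \<in> V \<Longrightarrow> P (t *s x) = t *s P x"
    "\<And>f. f \<in> coord_ring H \<Longrightarrow> (\<lambda>x. if x \<in> V then f (P x) else 0) \<in> coord_ring V"
    using retraction by blast
  \<comment> \<open>The correction \<open>c\<^sub>i / \<kappa>\<close>, lifted to \<open>V\<close>.\<close>
  define a where "a i = (\<lambda>x. (1 / \<kappa>) * (if x \<in> V then c i (P x) else 0))" for i
  have a: "a i \<in> coord_ring V" if "i \<in> I" for i
    unfolding a_def by (intro coord_ring_scale P(4) c(1) that)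
  define w' where "w' i = (if i = k then (\<lambda>x. \<alpha> x *s w k x) else (\<lambda>x. w i x - a i x *s w k x))" for i
  define J where "J = I - {k}"
  have J: "finite J" "k \<notin> J" "I = insert k J" "\<And>i. i \<in> J \<Longrightarrow> i \<in> I \<and> i \<noteq> k"
    using fin k by (auto simp: J_def)
  \<comment> \<open>Any combination of the new fields, rewritten in terms of the old ones.\<close>
  have sum_w': "(\<Sum>i\<in>I. g i x *s w' i x)
      = (\<Sum>i\<in>J. g i x *s w i x) + (g k x * \<alpha> x - (\<Sum>i\<in>J. g i x * a i x)) *s w k x" for g x
  proof -
    have "(\<Sum>i\<in>J. g i x *s w' i x) = (\<Sum>i\<in>J. g i x *s w i x - (g i x * a i x) *s w k x)"
      using J(4) by (intro sum.cong) (auto simp: w'_def vec.scale_right_diff_distrib)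
    also have "\<dots> = (\<Sum>i\<in>J. g i x *s w i x) - (\<Sum>i\<in>J. g i x * a i x) *s w k x"
      by (simp add: sum_subtractf vec.scale_sum_left)
    finally show ?thesis
      using J(1-3) by (simp add: w'_def vec.scale_left_diff_distrib)
  qed
  have "tangent_basis V (insert H A) I w' (d(k := Suc b))"
    unfolding tangent_basis_def
  proof (intro conjI ballI allI impI fin)
    fix i assume i: "i \<in> I"
    show "w' i \<in> tangent_fields V (insert H A)"
    proof (cases "i = k")
      case True
      have "(\<lambda>x. \<Sum>i\<in>{k}. \<alpha> x *s w i x) \<in> tangent_fields V A"
        using tangent_fields_sum[OF arrangement, of "{k}" "\<lambda>_. \<alpha>" w] wt k coord_ring.form[OF form_\<alpha>] by blast
      then show ?thesis
        using True linear_forms_zero[OF form_\<alpha> subspace_V] \<alpha>_zero by (simp add: w'_def tangent_insert_iff)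
    next
      case False
      define e where "e j = (if j = i then const_on V 1 else - a i)" for j
      have "e j \<in> coord_ring V" for j
        using coord_ring.const[of V 1] coord_ring_uminus[OF a[OF i]] by (cases "j = i") (simp_all only: e_def refl if_True if_False)
      then have "(\<lambda>x. \<Sum>j\<in>{i, k}. e j x *s w j x) \<in> tangent_fields V A"
        using wt k(1) i by (intro tangent_fields_sum[OF arrangement]) auto
      moreover have "(\<lambda>x. \<Sum>j\<in>{i, k}. e j x *s w j x) = w' i"
      proof
        fix x
        have "const_on V 1 x *s w i x = w i x"
          using poly_field_outside[OF wf[OF i], of x] by (cases "x \<in> V") (auto simp: const_on_def)
        then show "(\<Sum>j\<in>{i, k}. e j x *s w j x) = w' i x" using False by (simp add: e_def w'_def)
      qed
      ultimately have "w' i \<in> tangent_fields V A" by simp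
      moreover have "\<alpha> (w' i x) = 0" if x: "x \<in> H" for x
      proof -
        have "x \<in> V" using x subspace_H by blast
        then have "\<alpha> (w' i x) = \<alpha> (w i x) - a i x * \<alpha> (w k x)"
          using False wf[OF i] wf[OF k(1)] form_\<alpha> subspace_V
          by (simp add: w'_def linear_forms_diff_scaled poly_field_def)
        then show ?thesis
          using x \<open>x \<in> V\<close> \<kappa> c(2)[OF i x] c(2)[OF k(1) x] ck_const[OF x] by (simp add: a_def P)
      qed
      ultimately show ?thesis by (simp add: tangent_insert_iff)
    qed
    show "homogeneous_field V ((d(k := Suc b)) i) (w' i)"
      unfolding homogeneous_field_def
    proof (intro allI ballI)
      fix t x assume x: "x \<in> V"
      show "w' i (t *s x) = t ^ (d(k := Suc b)) i *s w' i x"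
      proof (cases "i = k")
        case True
        then show ?thesis
          using wh[OF k(1)] k(2) x form_\<alpha> by (simp add: w'_def homogeneous_field_def linear_forms_scale mult_ac)
      next
        case False
        have "t ^ b * a i (t *s x) = t ^ d i * a i x"
          using scaling[OF i P(1)[OF x], of t] x subspace_V P(3)[OF x] by (simp add: a_def vec.subspace_scale)
        then show ?thesis
          using wh[OF k(1)] wh[OF i] k(2) x False
          by (simp add: w'_def homogeneous_field_def vec.scale_right_diff_distrib mult.commute)
      qed
    qed
  next
    fix u assume "u \<in> tangent_fields V (insert H A)"
    then have u: "u \<in> tangent_fields V A" "\<And>x. x \<in> H \<Longrightarrow> \<alpha> (u x) = 0" by (auto simp: tangent_insert_iff)
    obtain g where g: "\<And>i. i \<in> I \<Longrightarrow> g i \<in> coord_ring V" "u = (\<lambda>x. \<Sum>i\<in>I. g i x *s w i x)"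
      using tangent_basis_span[OF basis u(1)] by blast
    \<comment> \<open>The coefficient of \<open>w k\<close> when \<open>u\<close> is expanded in the corrected fields and \<open>w k\<close>.\<close>
    define h where "h = g k + (\<Sum>i\<in>J. g i * a i)"
    have h: "h \<in> coord_ring V"
      unfolding h_def using g(1) a k J(4) by (intro coord_ring.add coord_ring_sum coord_ring.mult) auto
    have u_eq: "u x = (\<Sum>i\<in>J. g i x *s w i x) + g k x *s w k x" for x
      using J(1-3) by (simp add: g(2))
    have hx: "h x = g k x + (\<Sum>i\<in>J. g i x * a i x)" for x by (simp add: h_def fun_sum_apply)
    have "B x * h x = 0" if x: "x \<in> H" for x
    proof -
      have xV: "x \<in> V" using x subspace_H by blast
      have lin: "\<alpha> (\<Sum>i\<in>S. g i x *s w i x) = (\<Sum>i\<in>S. g i x * \<alpha> (w i x))" if "S \<subseteq> I" for S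
        using that
      proof (induction S rule: infinite_finite_induct)
        case (insert i S)
        have "(\<Sum>i\<in>S. g i x *s w i x) \<in> V"
          using subspace_V wf xV insert.prems by (intro vec.subspace_sum vec.subspace_scale) (auto simp: poly_field_def)
        then show ?case
          using insert wf xV subspace_V form_\<alpha> by (simp add: linear_forms_add linear_forms_scale vec.subspace_scale poly_field_def)
      qed (use linear_forms_zero[OF form_\<alpha> subspace_V] in auto)
      have "0 = \<alpha> (\<Sum>i\<in>I. g i x *s w i x)" using u(2)[OF x] by (simp add: g(2))
      also have "\<dots> = (\<Sum>i\<in>I. g i x * (B x * c i x))" using c(2) x by (simp add: lin)
      also have "\<dots> = g k x * (B x * \<kappa>) + (\<Sum>i\<in>J. g i x * (B x * (\<kappa> * a i x)))"
        using J x xV \<kappa> ck_const by (simp add: a_def P)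
      also have "\<dots> = \<kappa> * (B x * h x)"
        by (simp add: hx distrib_left sum_distrib_left mult_ac)
      finally show ?thesis using \<kappa> by simp
    qed
    then have "(\<forall>x\<in>H. B x = 0) \<or> (\<forall>x\<in>H. (if x \<in> H then h x else 0) = 0)"
      by (intro coord_ring_domain[OF subspace_H(1) subspace_H(1) order_refl homogeneous_coord_ring[OF B(1)] coord_ring_restrict[OF subspace_H h]]) auto
    then have "\<forall>x\<in>H. h x = 0" using B(2) by auto
    then obtain h' where h': "h' \<in> coord_ring V" "h = \<alpha> * h'"
      using coord_ring_factor[OF subspace_V form_\<alpha> h] \<alpha>_zero_iff by blast
    show "\<exists>c. (\<forall>i\<in>I. c i \<in> coord_ring V) \<and> u = (\<lambda>x. \<Sum>i\<in>I. c i x *s w' i x)"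
    proof (intro exI conjI ballI)
      show "(g(k := h')) i \<in> coord_ring V" if "i \<in> I" for i using that g(1) h'(1) by simp
      show "u = (\<lambda>x. \<Sum>i\<in>I. (g(k := h')) i x *s w' i x)"
      proof
        fix x
        have "(\<Sum>i\<in>J. (g(k := h')) i x *s w i x) = (\<Sum>i\<in>J. g i x *s w i x)"
          "(\<Sum>i\<in>J. (g(k := h')) i x * a i x) = (\<Sum>i\<in>J. g i x * a i x)"
          using J(2) by (auto intro!: sum.cong)
        moreover have "h' x * \<alpha> x - (\<Sum>i\<in>J. g i x * a i x) = g k x"
        proof -
          have "h' x * \<alpha> x = h x" using fun_cong[OF h'(2), of x] by (simp add: mult.commute)
          then show ?thesis using hx[of x] by simp
        qed
        ultimately show "u x = (\<Sum>i\<in>I. (g(k := h')) i x *s w' i x)"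
          unfolding sum_w' u_eq by simp
      qed
    qed
  next
    fix g i assume g: "(\<forall>i\<in>I. g i \<in> coord_ring V) \<and> (\<forall>x. (\<Sum>i\<in>I. g i x *s w' i x) = 0)" and i: "i \<in> I"
    define h where "h = g(k := g k * \<alpha> - (\<Sum>i\<in>J. g i * a i))"
    have "\<forall>i\<in>I. h i = 0"
    proof (rule tangent_basis_indep[OF basis])
      show "h i \<in> coord_ring V" if "i \<in> I" for i
      proof (cases "i = k")
        case True
        have "g k * \<alpha> - (\<Sum>i\<in>J. g i * a i) \<in> coord_ring V"
          using g a J(4) k by (intro coord_ring_diff coord_ring_sum coord_ring.mult coord_ring.form[OF form_\<alpha>]) auto
        then show ?thesis using True by (simp only: h_def fun_upd_same)
      qed (use g that in \<open>simp add: h_def\<close>)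
      show "(\<Sum>i\<in>I. h i x *s w i x) = 0" for x
      proof -
        have "(\<Sum>i\<in>J. h i x *s w i x) = (\<Sum>i\<in>J. g i x *s w i x)"
          using J(2) by (intro sum.cong) (auto simp: h_def)
        then have "(\<Sum>i\<in>I. h i x *s w i x) = (\<Sum>i\<in>I. g i x *s w' i x)"
          unfolding sum_w' using J(1-3) by (simp add: h_def fun_sum_apply)
        then show ?thesis using g by simp
      qed
    qed
    then have gJ: "g i = 0" if "i \<in> J" for i using that J(3,4) by (auto simp: h_def)
    have "h k = 0" using \<open>\<forall>i\<in>I. h i = 0\<close> k by blast
    then have "\<alpha> * g k = \<alpha> * 0" using gJ by (simp add: h_def mult.commute)
    moreover have "\<alpha> \<noteq> 0"
      using hyperplane_psubset[OF hyperplane] \<alpha>_zero_iff by (auto simp: fun_eq_iff)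
    ultimately have "g k = 0"
      using coord_ring_cancel[OF subspace_V coord_ring.form[OF form_\<alpha>] _ coord_ring_zero] g k by blast
    then show "g i = 0" using gJ J(3) i by blast
  qed
  then show ?thesis by blast
qed

text \<open>
  Suppose that all \<open>w\<^sub>i\<close> of degree at most \<open>b\<close> are tangent to \<open>H\<close>.  Their restrictions to \<open>H\<close> are
  combinations of the \<open>\<eta>\<^sub>j\<close> of degree at most \<open>b\<close>, of which there is one fewer.  So there is a nontrivial
  relation between them on \<open>H\<close>.  Lifted to \<open>V\<close>, it gives a field that vanishes on \<open>H\<close>, and dividing
  this field by \<open>\<alpha>\<close> gives another element of \<open>D(A)\<close>.  By uniqueness of coefficients, the
  coefficients of the relation are divisible by \<open>\<alpha>\<close>, that is, they vanish on \<open>H\<close>.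
\<close>

lemma basis_element_not_tangent:
  assumes basis: "tangent_basis V A I w d" and basis'': "tangent_basis H restriction J \<eta> \<delta>"
    and degrees: "image_mset d (mset_set I) = add_mset b (image_mset \<delta> (mset_set J))"
  shows "\<exists>i\<in>I. d i \<le> b \<and> w i \<notin> tangent_fields V (insert H A)"
proof (rule ccontr)
  assume "\<not> ?thesis"
  then have tangent: "w i \<in> tangent_fields V (insert H A)" if "i \<in> I" "d i \<le> b" for i using that by blast
  have fin: "finite I" "finite J" by (rule tangent_basis_finite[OF basis], rule tangent_basis_finite[OF basis''])
  define I' where "I' = {i\<in>I. d i \<le> b}"
  define J' where "J' = {j\<in>J. \<delta> j \<le> b}"
  have size_filter: "size (filter_mset P (image_mset f (mset_set S))) = card {s\<in>S. P (f s)}"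
    if "finite S" for S :: "'s set" and f P
    using that by (simp add: filter_mset_image_mset filter_mset_mset_set)
  have "card I' = size (filter_mset (\<lambda>n. n \<le> b) (add_mset b (image_mset \<delta> (mset_set J))))"
    unfolding degrees[symmetric] size_filter[OF fin(1)] I'_def ..
  also have "\<dots> = Suc (card J')" by (simp add: size_filter[OF fin(2)] J'_def)
  finally have card: "card J' < card I'" by simp
  define r where "r i = (\<lambda>x. if x \<in> H then w i x else 0)" for i
  have "\<exists>m. (\<forall>j\<in>J. m j \<in> coord_ring H) \<and> r i = (\<lambda>x. \<Sum>j\<in>J. m j x *s \<eta> j x) \<and> (\<forall>j\<in>J - J'. m j = 0)"
    if i: "i \<in> I'" for i
  proof -
    have iI: "i \<in> I" "d i \<le> b" using i by (auto simp: I'_def)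
    have "r i \<in> tangent_fields H restriction"
      unfolding r_def by (rule restrict_tangent[OF tangent[OF iI]])
    then obtain m where m: "\<And>j. j \<in> J \<Longrightarrow> m j \<in> coord_ring H" "r i = (\<lambda>x. \<Sum>j\<in>J. m j x *s \<eta> j x)"
      using tangent_basis_span[OF basis''] by blast
    have "homogeneous_field H (d i) (r i)"
      using tangent_basis_homogeneous[OF basis iI(1)] subspace_H
      by (auto simp: homogeneous_field_def r_def vec.subspace_scale subset_iff)
    then have "m j = 0" if "j \<in> J - J'" for j
      using that iI(2) m(2) by (intro expansion_degree[OF subspace_H(1) basis'' m(1)]) (auto simp: J'_def)
    then show ?thesis using m by blast
  qed
  then have "\<forall>i\<in>I'. \<exists>m. (\<forall>j\<in>J. m j \<in> coord_ring H) \<and> r i = (\<lambda>x. \<Sum>j\<in>J. m j x *s \<eta> j x) \<and> (\<forall>j\<in>J - J'. m j = 0)"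
    by blast
  from bchoice[OF this] obtain M where M: "\<And>i j. i \<in> I' \<Longrightarrow> j \<in> J \<Longrightarrow> M i j \<in> coord_ring H"
    "\<And>i. i \<in> I' \<Longrightarrow> r i = (\<lambda>x. \<Sum>j\<in>J. M i j x *s \<eta> j x)"
    "\<And>i j. i \<in> I' \<Longrightarrow> j \<in> J - J' \<Longrightarrow> M i j = 0"
    by blast
  have one: "\<exists>e\<in>coord_ring H. e \<noteq> 0"
  proof
    show "const_on H 1 \<in> coord_ring H" by (rule coord_ring.const)
    show "const_on H 1 \<noteq> 0"
      using vec.subspace_0[OF subspace_H(1)] by (auto simp: const_on_def fun_eq_iff)
  qed
  have dom: "f = 0 \<or> g = 0" if "f \<in> coord_ring H" "g \<in> coord_ring H" "f * g = 0" for f g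
    using coord_ring_cancel[OF subspace_H(1) that(1,2) coord_ring_zero] that(3) by (metis mult_zero_right)
  have "\<exists>c. (\<forall>i\<in>I'. c i \<in> coord_ring H) \<and> (\<exists>i\<in>I'. c i \<noteq> 0) \<and> (\<forall>j\<in>J'. (\<Sum>i\<in>I'. c i * M i j) = 0)"
  proof (rule dependent_rows[OF coord_ring_zero coord_ring_diff coord_ring.mult dom one])
    show "finite J'" "finite I'" "card J' < card I'" using fin card by (auto simp: I'_def J'_def)
    show "M i j \<in> coord_ring H" if "i \<in> I'" "j \<in> J'" for i j using that M(1) by (simp add: J'_def)
  qed
  then obtain c where c: "\<And>i. i \<in> I' \<Longrightarrow> c i \<in> coord_ring H" "\<exists>i\<in>I'. c i \<noteq> 0"
    "\<And>j. j \<in> J' \<Longrightarrow> (\<Sum>i\<in>I'. c i * M i j) = 0" by blast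
  have relation: "(\<Sum>i\<in>I'. c i x *s w i x) = 0" if x: "x \<in> H" for x
  proof -
    have "(\<Sum>i\<in>I'. c i x *s w i x) = (\<Sum>i\<in>I'. c i x *s (\<Sum>j\<in>J. M i j x *s \<eta> j x))"
    proof (rule sum.cong)
      fix i assume "i \<in> I'"
      then show "c i x *s w i x = c i x *s (\<Sum>j\<in>J. M i j x *s \<eta> j x)"
        using fun_cong[OF M(2), of i x] x by (simp add: r_def)
    qed simp
    also have "\<dots> = (\<Sum>i\<in>I'. \<Sum>j\<in>J. (c i x * M i j x) *s \<eta> j x)"
      by (simp add: vec.scale_sum_right)
    also have "\<dots> = (\<Sum>j\<in>J. (\<Sum>i\<in>I'. c i x * M i j x) *s \<eta> j x)"
      by (subst sum.swap) (simp add: vec.scale_sum_left)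
    also have "\<dots> = 0"
    proof (rule sum.neutral, rule ballI)
      fix j assume j: "j \<in> J"
      have "(\<Sum>i\<in>I'. c i x * M i j x) = 0"
      proof (cases "j \<in> J'")
        case True
        from fun_cong[OF c(3)[OF True], of x] show ?thesis by (simp add: fun_sum_apply)
      qed (use M(3) j in simp)
      then show "(\<Sum>i\<in>I'. c i x * M i j x) *s \<eta> j x = 0" by simp
    qed
    finally show ?thesis .
  qed
  obtain P where P: "\<And>x. x \<in> V \<Longrightarrow> P x \<in> H" "\<And>x. x \<in> H \<Longrightarrow> P x = x"
    "\<And>t x. x \<in> V \<Longrightarrow> P (t *s x) = t *s P x"
    "\<And>f. f \<in> coord_ring H \<Longrightarrow> (\<lambda>x. if x \<in> V then f (P x) else 0) \<in> coord_ring V"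
    using retraction by blast
  define a where "a i = (if i \<in> I' then (\<lambda>x. if x \<in> V then c i (P x) else 0) else 0)" for i
  have a: "a i \<in> coord_ring V" for i
    using P(4)[OF c(1), of i] coord_ring_zero by (cases "i \<in> I'") (simp_all only: a_def if_True if_False)
  have aH: "a i x = c i x" if "i \<in> I'" "x \<in> H" for i x using that P(2) subspace_H by (auto simp: a_def)
  have a0: "a i = 0" if "i \<notin> I'" for i using that by (simp add: a_def)
  define u where "u x = (\<Sum>i\<in>I. a i x *s w i x)" for x
  have u: "u \<in> tangent_fields V A"
    unfolding u_def using a tangent_basis_tangent[OF basis] by (intro tangent_fields_sum[OF arrangement]) auto
  have "u x = 0" if x: "x \<in> H" for x
  proof -
    have "u x = (\<Sum>i\<in>I'. a i x *s w i x)"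
      unfolding u_def using fin a0 by (intro sum.mono_neutral_right) (auto simp: I'_def)
    also have "\<dots> = (\<Sum>i\<in>I'. c i x *s w i x)" using x aH by simp
    finally show ?thesis using relation[OF x] by simp
  qed
  then obtain u' where u': "u' \<in> tangent_fields V A" "u = (\<lambda>x. \<alpha> x *s u' x)"
    using divide_by_form[OF u] by blast
  obtain g where g: "\<And>i. i \<in> I \<Longrightarrow> g i \<in> coord_ring V" "u' = (\<lambda>x. \<Sum>i\<in>I. g i x *s w i x)"
    using tangent_basis_span[OF basis u'(1)] by blast
  have "a i = \<alpha> * g i" if "i \<in> I" for i
  proof (rule tangent_basis_unique[OF basis _ _ _ that])
    show "(\<Sum>i\<in>I. a i x *s w i x) = (\<Sum>i\<in>I. (\<alpha> * g i) x *s w i x)" for x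
      using fun_cong[OF u'(2), of x] by (simp add: u_def g(2) vec.scale_sum_right)
    show "\<alpha> * g j \<in> coord_ring V" if "j \<in> I" for j
      using that by (intro coord_ring.mult coord_ring.form form_\<alpha> g(1))
  qed (rule a)
  then have "c i x = 0" if "i \<in> I'" "x \<in> H" for i x
    using that aH[OF that] \<alpha>_zero by (simp add: I'_def)
  then have "c i = 0" if "i \<in> I'" for i
    using that c(1) coord_ring_zero by (intro coord_ring_eqI[of _ H]) auto
  then show False using c(2) by blast
qed

theorem free_with_insert:
  assumes free: "free_with V A (add_mset b E)" and free'': "free_with H restriction E"
    and card: "card A = card restriction + b"
  shows "free_with V (insert H A) (add_mset (Suc b) E)"
proof -
  obtain I :: "nat set" and w d where basis: "tangent_basis V A I w d"
    and degI: "add_mset b E = image_mset d (mset_set I)" using free by (auto simp: free_with_def)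
  obtain J :: "nat set" and \<eta> \<delta> where basis'': "tangent_basis H restriction J \<eta> \<delta>"
    and degJ: "E = image_mset \<delta> (mset_set J)" using free'' by (auto simp: free_with_def)
  obtain B where B: "homogeneous H b B" "\<exists>x\<in>H. B x \<noteq> 0"
    "\<And>w. w \<in> tangent_fields V A \<Longrightarrow> \<exists>c\<in>coord_ring H. \<forall>x\<in>H. \<alpha> (w x) = B x * c x"
    using form_value_factor[OF card] by blast
  have "\<exists>c. \<forall>i\<in>I. c i \<in> coord_ring H \<and> (\<forall>x\<in>H. \<alpha> (w i x) = B x * c i x)"
    using B(3) tangent_basis_tangent[OF basis] by (intro bchoice) blast
  then obtain c where c: "\<And>i. i \<in> I \<Longrightarrow> c i \<in> coord_ring H"
    "\<And>i x. i \<in> I \<Longrightarrow> x \<in> H \<Longrightarrow> \<alpha> (w i x) = B x * c i x" by blast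
  obtain k where k: "k \<in> I" "d k \<le> b" "w k \<notin> tangent_fields V (insert H A)"
    using basis_element_not_tangent[OF basis basis''] degI degJ by metis
  have ck: "c k \<noteq> 0"
    using k c(2)[OF k(1)] tangent_basis_tangent[OF basis k(1)] by (auto simp: tangent_insert_iff)
  have dk: "d k = b"
  proof (rule ccontr)
    assume "d k \<noteq> b"
    then have "c k x = 0" if "x \<in> H" for x
      using scaling_degree_zero[OF subspace_H(1) c(1)[OF k(1)] that, of "d k" b] k(2)
        coefficient_scaling[OF B(1,2) c(1)[OF k(1)] tangent_basis_poly_field[OF basis k(1)]
          tangent_basis_homogeneous[OF basis k(1)] c(2)[OF k(1)] that] by simp
    then have "c k = 0" using c(1)[OF k(1)] coord_ring_zero by (intro coord_ring_eqI[of _ H]) auto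
    then show False using ck by simp
  qed
  obtain w' where "tangent_basis V (insert H A) I w' (d(k := Suc b))"
    using exchange_basis[OF basis k(1) dk B(1,2) c ck] by blast
  moreover have "add_mset (Suc b) E = image_mset (d(k := Suc b)) (mset_set I)"
  proof -
    have I: "mset_set I = add_mset k (mset_set (I - {k}))"
      using mset_set.remove[OF tangent_basis_finite[OF basis] k(1)] .
    have "E = image_mset d (mset_set (I - {k}))" using degI dk unfolding I by simp
    also have "\<dots> = image_mset (d(k := Suc b)) (mset_set (I - {k}))"
      using tangent_basis_finite[OF basis] by (intro image_mset_cong) auto
    finally show ?thesis unfolding I by simp
  qed
  ultimately show ?thesis unfolding free_with_def by blast
qed

end

section \<open>Inductive freeness in dimensions one, two and three\<close>

text \<open>
  The number of hyperplanes is carried along because it determines the degree of the form \<open>B\<close>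
  in the addition theorem.
\<close>

definition inductively_free_with ::
  "('k::field_char_0 ^ 'n) set \<Rightarrow> ('k ^ 'n) set set \<Rightarrow> nat multiset \<Rightarrow> bool" where
  "inductively_free_with V A E \<longleftrightarrow>
     arrangement V A \<and> inductively_free V A \<and> free_with V A E \<and> card A = sum_mset E"

lemma inductively_free_with_empty:
  "vec.subspace V \<Longrightarrow> inductively_free_with V {} (replicate_mset (vec.dim V) 0)"
  by (simp add: inductively_free_with_def arrangement_def inductively_free.empty free_with_empty
      sum_mset_replicate_mset)

lemma (in hyperplane_addition) inductively_free_with_insert:
  assumes A: "inductively_free_with V A (add_mset b E)" and A'': "inductively_free_with H restriction E"
  shows "inductively_free_with V (insert H A) (add_mset (Suc b) E)"
proof -
  have del: "insert H A - {H} = A" using new by simp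
  have "card A = card restriction + b" using A A'' by (simp add: inductively_free_with_def)
  then have "free_with V (insert H A) (add_mset (Suc b) E)"
    using A A'' by (intro free_with_insert) (auto simp: inductively_free_with_def)
  moreover have "inductively_free V (insert H A)"
  proof (rule inductively_free.add[where H = H and E' = "add_mset b E" and E'' = E])
    show "exponents V (insert H A - {H}) (add_mset b E)"
      unfolding del using A by (simp add: inductively_free_with_def free_with_exponents)
    show "exponents H ((\<lambda>K. H \<inter> K) ` (insert H A - {H})) E"
      unfolding del using A'' by (simp add: inductively_free_with_def free_with_exponents)
  qed (use insert_arrangement A A'' new in \<open>simp_all add: del inductively_free_with_def\<close>)
  ultimately show ?thesis
    using insert_arrangement A finite_A new by (simp add: inductively_free_with_def)
qed

lemma inductively_free_with_dim1:
  assumes V: "vec.subspace V" and dim: "vec.dim V = 1"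
  shows "inductively_free_with V {{0}} {#1#}"
proof -
  interpret hyperplane_addition V "{0}" "{}"
    using V dim vec.subspace_0[OF V]
    by unfold_locales (auto simp: arrangement_def hyperplane_of_def)
  show ?thesis
    using inductively_free_with_insert[of 0 "{#}"] inductively_free_with_empty[OF V]
      inductively_free_with_empty[of "{0}"] dim by auto
qed

text \<open>
  Any further line meets the present lines only in the origin, so that the restriction is always the
  same arrangement, with exponent 1, and the other exponent grows by one.
\<close>

lemma inductively_free_with_dim2:
  assumes A: "arrangement V A" "A \<noteq> {}" and dim: "vec.dim V = 2"
  shows "inductively_free_with V A {#1, card A - 1#}"
proof -
  have V: "vec.subspace V" and "finite A" using A by (auto simp: arrangement_def)
  from \<open>finite A\<close> A(2,1) show ?thesis
  proof (induction rule: finite_ne_induct)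
    case (singleton H)
    then have H: "hyperplane_of V H" by (simp add: arrangement_def)
    then have dimH: "vec.subspace H" "vec.dim H = 1" using dim by (auto simp: hyperplane_of_def)
    interpret hyperplane_addition V H "{}"
      using V H by unfold_locales (auto simp: arrangement_def)
    show ?case
      using inductively_free_with_insert[of 0 "{#0#}"] inductively_free_with_empty[OF V]
        inductively_free_with_empty[OF dimH(1)] dim dimH
      by (simp add: numeral_2_eq_2 add_mset_commute)
  next
    case (insert H A)
    then have H: "hyperplane_of V H" and A: "arrangement V A" by (auto simp: arrangement_def)
    then have dimH: "vec.subspace H" "vec.dim H = 1" using dim by (auto simp: hyperplane_of_def)
    interpret hyperplane_addition V H A using H A insert.hyps by unfold_locales auto
    have "X = {0}" if "X \<in> restriction" for X
    proof -
      have "hyperplane_of H X" using restriction_arrangement that by (auto simp: arrangement_def)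
      then have "vec.subspace X" "vec.dim X = 0" using dimH by (auto simp: hyperplane_of_def)
      then show ?thesis using vec.subspace_0 by (auto simp: vec.dim_eq_0)
    qed
    then have "restriction = {{0}}" using insert.hyps by blast
    moreover have "card A > 0" using insert.hyps by (auto simp: card_gt_0_iff)
    ultimately show ?case
      using inductively_free_with_insert[of "card A - 1" "{#1#}"] insert.IH[OF A]
        inductively_free_with_dim1[OF dimH] insert.hyps by (simp add: add_mset_commute)
  qed
qed

lemma inductively_free_with_dim3_singleton:
  assumes space: "vec.subspace V" "vec.dim V = 3" and H: "hyperplane_of V H"
  shows "inductively_free_with V {H} {#1, 0, 0#}"
proof -
  have dimH: "vec.subspace H" "vec.dim H = 2" using H space by (auto simp: hyperplane_of_def)
  interpret hyperplane_addition V H "{}"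
    using space H by unfold_locales (auto simp: arrangement_def)
  show ?thesis
    using inductively_free_with_insert[of 0 "{#0, 0#}"] inductively_free_with_empty[OF space(1)]
      inductively_free_with_empty[OF dimH(1)] space dimH
    by (simp add: numeral_3_eq_3 numeral_2_eq_2 add_mset_commute)
qed

lemma inductively_free_with_dim3_insert:
  assumes V: "vec.dim V = 3" and H: "hyperplane_of V H" "H \<notin> A"
    and A: "inductively_free_with V A {#1, a, b#}" and card: "card ((\<lambda>K. H \<inter> K) ` A) = Suc a"
  shows "inductively_free_with V (insert H A) {#1, a, Suc b#}"
proof -
  have dimH: "vec.dim H = 2" using H V by (auto simp: hyperplane_of_def)
  interpret hyperplane_addition V H A
    using A H by unfold_locales (auto simp: inductively_free_with_def)
  have "restriction \<noteq> {}" using card by auto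
  then have "inductively_free_with H restriction {#1, a#}"
    using inductively_free_with_dim2[OF restriction_arrangement _ dimH] card by simp
  then show ?thesis
    using inductively_free_with_insert[of b "{#1, a#}"] A by (simp add: add_mset_commute)
qed

section \<open>Lines with integer coefficients\<close>

type_synonym triple = "int \<times> int \<times> int"

definition root_three :: complex where "root_three = complex_of_real (sqrt 3)"

lemma root_three_square: "root_three * root_three = 3"
  unfolding root_three_def by (metis of_real_mult of_real_numeral real_sqrt_mult_self abs_numeral)

lemma root_three_nonzero: "root_three \<noteq> 0"
  by (simp add: root_three_def)

text \<open>
  The triple \<open>(p, q, r)\<close> stands for \<open>p x + q (\<surd>3 y) + r (\<surd>3 z) = 0\<close>.
\<close>

fun scaled_line :: "triple \<Rightarrow> (complex ^ 3) set" where
  "scaled_line (p, q, r) = line (of_int p) (of_int q * root_three) (of_int r * root_three)"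

fun dot :: "triple \<Rightarrow> triple \<Rightarrow> int" where
  "dot (a, b, c) (p, q, r) = a * p + b * q + c * r"

fun cross :: "triple \<Rightarrow> triple \<Rightarrow> triple" where
  "cross (a, b, c) (p, q, r) = (b * r - c * q, c * p - a * r, a * q - b * p)"

fun scaled_point :: "triple \<Rightarrow> complex ^ 3" where
  "scaled_point (p, q, r) = vector [of_int p, of_int q / root_three, of_int r / root_three]"

lemma scaled_point_on_line: "scaled_point s \<in> scaled_line t \<longleftrightarrow> dot t s = 0"
proof -
  obtain a b c p q r where ts: "t = (a, b, c)" "s = (p, q, r)" by (metis prod_cases3)
  have "of_int (dot t s) = (of_int a * of_int p + of_int b * of_int q + of_int c * of_int r :: complex)"
    by (simp add: ts)
  then show ?thesis
    using root_three_nonzero of_int_eq_0_iff[of "dot t s", where 'a = complex]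
    by (simp add: ts line_def vector_3)
qed

lemma scaled_line_hyperplane:
  assumes "t \<noteq> (0, 0, 0)"
  shows "hyperplane_of UNIV (scaled_line t)"
proof -
  obtain a b c where t: "t = (a, b, c)" by (metis prod_cases3)
  define l :: "complex ^ 3 \<Rightarrow> complex" where
    "l v = of_int a * v $ 1 + (of_int b * root_three) * v $ 2 + (of_int c * root_three) * v $ 3" for v
  have "l \<in> linear_forms UNIV" by (simp add: linear_forms_def l_def algebra_simps)
  moreover have "\<exists>v\<in>UNIV. l v \<noteq> 0"
  proof (rule ccontr)
    assume "\<not> ?thesis"
    then have "l (vector [1, 0, 0]) = 0" "l (vector [0, 1, 0]) = 0" "l (vector [0, 0, 1]) = 0" by auto
    then show False using assms root_three_nonzero by (auto simp: l_def vector_3 t)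
  qed
  ultimately have "hyperplane_of UNIV {v\<in>UNIV. l v = 0}"
    by (intro hyperplane_kernel vec.subspace_UNIV)
  then show ?thesis by (simp add: t line_def l_def)
qed

lemma scaled_line_distinct:
  assumes "cross t k \<noteq> (0, 0, 0)"
  shows "scaled_line t \<noteq> scaled_line k"
proof
  obtain a b c p q r where tk: "t = (a, b, c)" "k = (p, q, r)" by (metis prod_cases3)
  assume "scaled_line t = scaled_line k"
  then have "dot t s = 0 \<longleftrightarrow> dot k s = 0" for s
    using scaled_point_on_line by metis
  from this[of "(0, c, - b)"] this[of "(- c, 0, a)"] this[of "(b, - a, 0)"]
  show False using assms by (auto simp: tk algebra_simps)
qed

text \<open>
  In the coordinates \<open>(x, \<surd>3 y, \<surd>3 z)\<close>, every point \<open>u\<close> of the first two lines is proportional to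
  \<open>c = t \<times> k\<close>, that is, \<open>c\<^sub>i u\<^sub>j = c\<^sub>j u\<^sub>i\<close>.  Hence \<open>c\<^sub>i (k' \<cdot> u) = u\<^sub>i (k' \<cdot> c) = 0\<close> for all \<open>i\<close>, and
  some \<open>c\<^sub>i\<close> is nonzero.
\<close>

lemma scaled_line_intersection_subset:
  assumes det: "dot k' (cross t k) = 0" and cross: "cross t k \<noteq> (0, 0, 0)"
  shows "scaled_line t \<inter> scaled_line k \<subseteq> scaled_line k'"
proof
  fix v assume v: "v \<in> scaled_line t \<inter> scaled_line k"
  obtain a b c p q r where tk: "t = (a, b, c)" "k = (p, q, r)" by (metis prod_cases3)
  obtain a' b' c' where k': "k' = (a', b', c')" by (metis prod_cases3)
  define x y z where xyz: "x = v $ 1" "y = root_three * v $ 2" "z = root_three * v $ 3"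
  define T1 T2 T3 K1 K2 K3 L1 L2 L3 :: complex where
    "T1 = of_int a" "T2 = of_int b" "T3 = of_int c" "K1 = of_int p" "K2 = of_int q" "K3 = of_int r"
    "L1 = of_int a'" "L2 = of_int b'" "L3 = of_int c'"
  note defs = this
  have T: "T1 * x + T2 * y + T3 * z = 0" and K: "K1 * x + K2 * y + K3 * z = 0"
    using v by (auto simp: tk line_def xyz defs mult_ac)
  have D: "L1 * (T2 * K3 - T3 * K2) + L2 * (T3 * K1 - T1 * K3) + L3 * (T1 * K2 - T2 * K1) = 0"
    using arg_cong[OF det, of "of_int :: int \<Rightarrow> complex"] by (simp add: tk k' defs)
  have "(T2 * K3 - T3 * K2) * (L1 * x + L2 * y + L3 * z) = 0"
    "(T3 * K1 - T1 * K3) * (L1 * x + L2 * y + L3 * z) = 0"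
    "(T1 * K2 - T2 * K1) * (L1 * x + L2 * y + L3 * z) = 0"
    using T K D by algebra+
  moreover have "T2 * K3 - T3 * K2 \<noteq> 0 \<or> T3 * K1 - T1 * K3 \<noteq> 0 \<or> T1 * K2 - T2 * K1 \<noteq> 0"
    using cross unfolding defs of_int_mult[symmetric] of_int_diff[symmetric] of_int_eq_0_iff
    by (simp add: tk)
  ultimately have "L1 * x + L2 * y + L3 * z = 0" by auto
  then show "v \<in> scaled_line k'" by (simp add: k' line_def xyz defs mult_ac)
qed

text \<open>
  The point in which two different lines meet is spanned by the cross product of their coefficient
  vectors, and it lies on the third line if and only if its product with the third coefficient vector
  vanishes.
\<close>

lemma scaled_line_intersection_eq_iff:
  assumes "cross t k \<noteq> (0, 0, 0)" "cross t k' \<noteq> (0, 0, 0)"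
  shows "scaled_line t \<inter> scaled_line k = scaled_line t \<inter> scaled_line k' \<longleftrightarrow> dot k' (cross t k) = 0"
proof
  obtain a b c p q r where tk: "t = (a, b, c)" "k = (p, q, r)" by (metis prod_cases3)
  obtain a' b' c' where k': "k' = (a', b', c')" by (metis prod_cases3)
  {
    assume eq: "scaled_line t \<inter> scaled_line k = scaled_line t \<inter> scaled_line k'"
    have "dot t (cross t k) = 0" "dot k (cross t k) = 0" by (simp_all add: tk algebra_simps)
    then have "scaled_point (cross t k) \<in> scaled_line t \<inter> scaled_line k"
      by (simp add: scaled_point_on_line)
    then have "scaled_point (cross t k) \<in> scaled_line k'" using eq by blast
    then show "dot k' (cross t k) = 0" by (simp add: scaled_point_on_line)
  }
  {
    assume det: "dot k' (cross t k) = 0"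
    then have "dot k (cross t k') = 0" by (simp add: tk k' algebra_simps)
    then show "scaled_line t \<inter> scaled_line k = scaled_line t \<inter> scaled_line k'"
      using scaled_line_intersection_subset[OF det assms(1)]
        scaled_line_intersection_subset[of k t k', OF _ assms(2)] by blast
  }
qed

fun count_classes :: "('a \<Rightarrow> 'a \<Rightarrow> bool) \<Rightarrow> 'a list \<Rightarrow> nat" where
  "count_classes R [] = 0"
| "count_classes R (x # xs) = (if list_ex (R x) xs then 0 else 1) + count_classes R xs"

lemma card_image_count_classes:
  assumes "\<And>x y. x \<in> set xs \<Longrightarrow> y \<in> set xs \<Longrightarrow> R x y \<longleftrightarrow> f x = f y"
  shows "card (f ` set xs) = count_classes R xs"
  using assms
proof (induction xs)
  case (Cons x xs)
  have "list_ex (R x) xs \<longleftrightarrow> f x \<in> f ` set xs"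
    using Cons.prems by (auto simp: list_ex_iff)
  then show ?case using Cons by (auto simp: card_insert_if)
qed simp

text \<open>
  The last element of the list is the line to start with, and lines are added from right to left.
  The result \<open>Some (a, b)\<close> means that the addition theorem applies at every step and
  leads to the exponents \<open>{1, a, b}\<close>.
\<close>

fun addition_exponents :: "triple list \<Rightarrow> (nat \<times> nat) option" where
  "addition_exponents [] = None"
| "addition_exponents [t] = (if t = (0, 0, 0) then None else Some (0, 0))"
| "addition_exponents (t # ts) = (case addition_exponents ts of None \<Rightarrow> None | Some (a, b) \<Rightarrow>
     (if list_all (\<lambda>k. cross t k \<noteq> (0, 0, 0)) ts then
        (let n = count_classes (\<lambda>k k'. dot k' (cross t k) = 0) ts in
         if n = Suc a then Some (a, Suc b) else if n = Suc b then Some (Suc a, b) else None)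
      else None))"

lemma addition_exponents_sound:
  "addition_exponents ts = Some (a, b) \<Longrightarrow>
    inductively_free_with UNIV (scaled_line ` set ts) {#1, a, b#}"
proof (induction ts arbitrary: a b rule: addition_exponents.induct)
  case (2 t)
  have "vec.dim (UNIV :: (complex ^ 3) set) = 3" by (simp add: vec.dim_UNIV card_cart_basis)
  then show ?case
    using 2 inductively_free_with_dim3_singleton[OF vec.subspace_UNIV _ scaled_line_hyperplane, of t]
    by (auto split: if_splits)
next
  case (3 t t' ts)
  let ?ts = "t' # ts" and ?n = "count_classes (\<lambda>k k'. dot k' (cross t k) = 0) (t' # ts)"
  obtain a' b' where ab': "addition_exponents ?ts = Some (a', b')"
    and cross: "list_all (\<lambda>k. cross t k \<noteq> (0, 0, 0)) ?ts"
    and n: "?n = Suc a' \<and> a = a' \<and> b = Suc b' \<or> ?n = Suc b' \<and> a = Suc a' \<and> b = b'"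
    using 3(2) by (auto simp: Let_def simp del: count_classes.simps split: option.splits if_splits)
  have IH: "inductively_free_with UNIV (scaled_line ` set ?ts) {#1, a', b'#}" by (rule 3(1)[OF ab'])
  have cross': "cross t k \<noteq> (0, 0, 0)" if "k \<in> set ?ts" for k using cross that unfolding list_all_iff by blast
  have dim: "vec.dim (UNIV :: (complex ^ 3) set) = 3" by (simp add: vec.dim_UNIV card_cart_basis)
  have "cross (0, 0, 0) t' = (0, 0, 0)" by (cases t') auto
  then have "t \<noteq> (0, 0, 0)" using cross'[of t'] by auto
  then have H: "hyperplane_of UNIV (scaled_line t)" by (rule scaled_line_hyperplane)
  have new: "scaled_line t \<notin> scaled_line ` set ?ts"
    using scaled_line_distinct cross' by blast
  have "card ((\<lambda>K. scaled_line t \<inter> K) ` scaled_line ` set ?ts) = ?n"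
    unfolding image_image
    by (rule card_image_count_classes) (use scaled_line_intersection_eq_iff cross' in blast)
  then show ?case
    using n inductively_free_with_dim3_insert[OF dim H new, of a' b']
      inductively_free_with_dim3_insert[OF dim H new, of b' a'] IH
    by (auto simp: add_mset_commute)
qed simp

definition triples :: "nat \<Rightarrow> triple list" where
  "triples k =
     concat (map (\<lambda>i. [(2, 0, - i), (1, - 1, i), (1, 1, - i)]) [- (int k + 1)..int k + 1]) @
     concat (map (\<lambda>j. [(0, 2, - j), (3, - 1, j), (3, 1, - j)]) [- (int k - 1)..int k - 1]) @
     [(0, 0, 1)]"

lemma line_scale: "c \<noteq> 0 \<Longrightarrow> line (c * p) (c * q) (c * r) = line p q r"
proof -
  assume c: "c \<noteq> 0"
  have "c * p * x + c * q * y + c * r * z = c * (p * x + q * y + r * z)" for x y z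
    by (simp add: algebra_simps)
  then show ?thesis using c by (simp add: line_def)
qed

text \<open>
  The equations without a factor \<open>\<surd>3\<close> at \<open>z\<close> are multiplied by \<open>\<surd>3\<close>.
\<close>

lemma arr_A_triples: "arr_A k = scaled_line ` set (triples k)"
proof -
  have e: "complex_of_real (sqrt 3) = root_three" by (simp add: root_three_def)
  have 1: "line 2 0 (- root_three * of_int i) = scaled_line (2, 0, - i)"
    "line 1 (- root_three) (root_three * of_int i) = scaled_line (1, - 1, i)"
    "line 1 root_three (- root_three * of_int i) = scaled_line (1, 1, - i)" for i
    by (simp_all add: mult.commute)
  have 2: "line 0 2 (- of_int j) = scaled_line (0, 2, - j)"
    "line root_three (- 1) (of_int j) = scaled_line (3, - 1, j)"
    "line root_three 1 (- of_int j) = scaled_line (3, 1, - j)" for j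
    using line_scale[OF root_three_nonzero, of 0 2 "- of_int j"]
      line_scale[OF root_three_nonzero, of root_three "- 1" "of_int j"]
      line_scale[OF root_three_nonzero, of root_three 1 "- of_int j"]
    by (simp_all add: mult.commute root_three_square)
  have 3: "line 0 0 1 = scaled_line (0, 0, 1)"
    using line_scale[OF root_three_nonzero, of 0 0 1] by simp
  show ?thesis
    unfolding arr_A_def Let_def e 1 2 3 triples_def
    by (simp add: image_Un image_UN Un_assoc)
qed

text \<open>
  This order and the next one were found by removing lines one after the other, each time a line whose
  number of intersection points is one more than one of the current exponents other than the exponent 1 of
  the Euler field.
\<close>

definition addition_order_19 :: "triple list" where
  "addition_order_19 = [(2, 0, 2), (1, - 1, - 2), (1, 1, 2), (1, 1, 1), (1, 1, - 2), (2, 0, - 1), (1, - 1, 1), (2, 0, 1),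
    (1, - 1, - 1), (1, 1, - 1), (1, 1, 0), (2, 0, - 2), (2, 0, 0), (1, - 1, 2), (1, - 1, 0),
    (3, - 1, 0), (3, 1, 0), (0, 0, 1), (0, 2, 0)]"

definition addition_order_31 :: "triple list" where
  "addition_order_31 = [(2, 0, 3), (1, - 1, - 3), (1, 1, 3), (2, 0, - 3), (1, - 1, 3), (1, 1, - 3), (2, 0, 2),
    (1, - 1, - 2), (1, 1, 2), (2, 0, - 2), (1, - 1, 2), (1, 1, - 2), (2, 0, 1), (1, - 1, - 1),
    (1, 1, 1), (2, 0, - 1), (1, - 1, 1), (1, 1, - 1), (2, 0, 0), (1, - 1, 0), (1, 1, 0), (0, 2, 1),
    (3, - 1, - 1), (3, 1, 1), (0, 2, 0), (3, - 1, 0), (0, 2, - 1), (3, 1, 0), (3, - 1, 1),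
    (3, 1, - 1), (0, 0, 1)]"

lemma addition_order_19_check: "set (triples 1) = set addition_order_19" "addition_exponents addition_order_19 = Some (7, 11)"
  by code_simp+

lemma addition_order_31_check: "set (triples 2) = set addition_order_31" "addition_exponents addition_order_31 = Some (13, 17)"
  by code_simp+

theorem theorem3p1:
  shows "inductively_free UNIV (arr_A 1) \<and> inductively_free UNIV (arr_A 2)"
  using addition_exponents_sound[OF addition_order_19_check(2)] addition_exponents_sound[OF addition_order_31_check(2)]
  unfolding arr_A_triples addition_order_19_check(1) addition_order_31_check(1) inductively_free_with_def by blast

end
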